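(* Let $\nu\in\left[-\frac12,\frac12\right]$ and let $h_{\nu,n}$, $h_{\nu,n}'$ and $h_{\nu,n}''$ denote the $n$th positive zeros ($n\ge1$) of $\mathbf{H}_\nu$, $\mathbf{H}_\nu'$ and $\mathbf{H}_\nu''$, respectively, where $\mathbf{H}_\nu$ is the Struve function of the first kind. Then $$\sum_{n\ge1}\frac{1}{h_{\nu,n}^2}=\frac{1}{3(2\nu+3)},\qquad \sum_{n\ge1}\frac{1}{h_{\nu,n}^4}=\frac{7-2\nu}{45(2\nu+3)^2(2\nu+5)},$$ $$\sum_{n\ge1}\frac{1}{(h_{\nu,n}')^2}=\frac{\nu+3}{3(\nu+1)(2\nu+3)},\qquad \sum_{n\ge1}\frac{1}{(h_{\nu,n}')^4}=\frac{-2\nu^3-5\nu^2+72\nu+135}{45(\nu+1)^2(2\nu+3)^2(2\nu+5)},$$ and, provided that in addition $\nu>0$, $$\sum_{n\ge1}\frac{1}{(h_{\nu,n}'')^2}=\frac{(\nu+2)(\nu+3)}{3\nu(\nu+1)(2\nu+3)},\qquad \sum_{n\ge1}\frac{1}{(h_{\nu,n}'')^4}=\frac{-2\nu^5-13\nu^4+92\nu^3+763\nu^2+1500\nu+900}{45\nu^2(\nu+1)^2(2\nu+3)^2(2\nu+5)}.$$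
   Context: The Struve function of the first kind is $\mathbf{H}_\nu(x)=\left(\frac{x}{2}\right)^{\nu+1}\sum_{m\ge0}\frac{(-1)^m}{\Gamma\left(m+\frac32\right)\Gamma\left(m+\nu+\frac32\right)}\left(\frac{x}{2}\right)^{2m}$; primes on $\mathbf{H}_\nu$ denote derivatives with respect to $x$. The positive zeros are listed in nondecreasing order and repeated according to multiplicity. *)

theory Defs
  imports "HOL-Complex_Analysis.Complex_Analysis"
begin

text \<open>The power is the principal branch, so \<open>struve_H \<nu>\<close> is holomorphic off the cut
  \<open>\<real>\<^sub>\<le>\<^sub>0\<close> and real-valued on the positive axis for real \<open>\<nu>\<close>. Since \<open>Gamma\<close> is \<open>0\<close> at its
  poles, terms with \<open>\<nu> + m + 3/2\<close> a pole vanish, as with the usual convention \<open>1/\<Gamma> = 0\<close>.\<close>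

definition struve_H :: "complex \<Rightarrow> complex \<Rightarrow> complex" where
  "struve_H \<nu> z = (z / 2) powr (\<nu> + 1) *
     (\<Sum>m. (-1) ^ m / (Gamma (of_nat m + 3 / 2) * Gamma (of_nat m + \<nu> + 3 / 2))
            * (z / 2) ^ (2 * m))"

text \<open>The sequence \<open>h\<close> lists the positive zeros of \<open>F\<close> in nondecreasing order, each as often as
  its multiplicity. At an isolated zero of an analytic function, \<open>zorder\<close> is positive, so the
  \<open>card\<close> condition forces \<open>{n. h n = x}\<close> to be finite.\<close>

definition lists_pos_zeros :: "(complex \<Rightarrow> complex) \<Rightarrow> (nat \<Rightarrow> real) \<Rightarrow> bool" where
  "lists_pos_zeros F h \<longleftrightarrow>
     mono h \<and>
     range h = {x. 0 < x \<and> F (of_real x) = 0} \<and>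
     (\<forall>x\<in>range h. int (card {n. h n = x}) = zorder F (of_real x))"

text \<open>At most one sequence lists the positive zeros of a function that is
  analytic on the positive axis and not identically zero there.
  Indexing starts at \<open>0\<close>: \<open>pos_zero F n\<close> is the \<open>(n + 1)\<close>-st positive zero.\<close>

definition pos_zero :: "(complex \<Rightarrow> complex) \<Rightarrow> nat \<Rightarrow> real" where
  "pos_zero F = (THE h. lists_pos_zeros F h)"

end

theory Submission
  imports Defs
    "HOL-Real_Asymp.Real_Asymp"
    "HOL-Computational_Algebra.Fundamental_Theorem_Algebra"
begin

text \<open>Write \<open>H\<^sub>\<nu>(z) = K (z/2)\<^bsup>\<nu>+1\<^esup> G(z\<^sup>2)\<close>; then \<open>H\<^sub>\<nu>'\<close> and \<open>H\<^sub>\<nu>''\<close> have the same shape, with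
  \<open>G\<close> replaced by \<open>s G + 2 w G'\<close> for \<open>s = \<nu> + 1\<close> and then \<open>s = \<nu>\<close>. With \<open>\<alpha> = \<nu> + 1/2 > 0\<close>, the function
  \<open>z G(z\<^sup>2)\<close> is a multiple of \<open>\<integral>\<^sub>0\<^sup>1 (1 - t\<^sup>2)\<^bsup>\<alpha>-1\<^esup> sin(zt) dt\<close>, whose weight is increasing for
  \<open>\<alpha> \<le> 1\<close>. Replacing the weight by a step function gives a sine sum with increasing coefficients,
  whose zeros are real by Enestrom--Kakeya, and Hurwitz's theorem passes to the limit (Polya).
  For \<open>\<alpha> = 0\<close>, \<open>z G(z\<^sup>2)\<close> is \<open>sin z\<close> itself. So the roots of \<open>G\<close> are real and positive.
  Since \<open>G\<close> grows at most like \<open>exp(A |w|\<^bsup>1/2\<^esup>)\<close>, dividing out the roots \<open>a\<close> in a disc of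
  radius \<open>R\<close> and applying the Borel--Caratheodory inequality to the logarithm of
  the quotient gives \<open>G'(w)/G(w) = \<Sum> 1/(w - a)\<close> as \<open>R\<close> tends to infinity. This identity yields the
  power sums of the reciprocal roots from the Taylor coefficients of \<open>G\<close> at \<open>0\<close>, and
  also shows that \<open>s G + 2 w G'\<close> with \<open>s > 0\<close> again has only positive roots.\<close>

section \<open>Entire functions of order less than one\<close>

text \<open>Near \<open>a\<close> the quotient is \<open>zor_poly f a\<close>, elsewhere it is
  \<open>f w / (w - a) ^ n\<close>; the two agree where both make sense and glue to an entire
  function. The hypothesis on \<open>z0\<close> rules out the zero function, for which no order
  exists.\<close>

lemma entire_factor_root:
  fixes f :: "complex \<Rightarrow> complex"
  assumes "f holomorphic_on UNIV" "f z0 \<noteq> 0"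
  obtains q where "q holomorphic_on UNIV" "q a \<noteq> 0" "\<And>w. f w = (w - a) ^ nat (zorder f a) * q w"
proof -
  let ?n = "nat (zorder f a)"
  obtain r where r: "r > 0" "zor_poly f a holomorphic_on cball a r"
    "\<And>w. w \<in> cball a r \<Longrightarrow> f w = zor_poly f a w * (w - a) ^ ?n \<and> zor_poly f a w \<noteq> 0"
    using zorder_exist_zero[of f UNIV a] assms by (metis UNIV_I connected_UNIV open_UNIV)
  define q where "q = (\<lambda>w. if w = a then zor_poly f a a else f w / (w - a) ^ ?n)"
  have eq: "q w = zor_poly f a w" if "w \<in> ball a r" for w
    using r(3)[of w] that by (auto simp: q_def)
  have "q holomorphic_on ball a r"
    using r(2) by (rule holomorphic_transform[OF holomorphic_on_subset]) (auto simp: eq)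
  moreover have "q holomorphic_on UNIV - {a}"
    by (rule holomorphic_transform[of "\<lambda>w. f w / (w - a) ^ ?n"])
       (auto intro!: holomorphic_intros holomorphic_on_subset[OF assms(1)] simp: q_def)
  ultimately have "q holomorphic_on ball a r \<union> (UNIV - {a})"
    by (intro holomorphic_on_Un) auto
  moreover have "ball a r \<union> (UNIV - {a}) = UNIV" using r(1) by auto
  ultimately have "q holomorphic_on UNIV" by simp
  moreover have "q a \<noteq> 0" using r(1) r(3)[of a] by (simp add: q_def)
  moreover have "f w = (w - a) ^ ?n * q w" for w
    using r(1) r(3)[of a] by (cases "w = a") (auto simp: q_def)
  ultimately show ?thesis using that by blast
qed

text \<open>Induction on \<open>S\<close>, splitting off one root at a time. The factors are
  normalised as \<open>1 - w / a\<close>, so that their product is 1 at 0 and the quotient agrees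
  there with \<open>f\<close>.\<close>

lemma entire_factor_finite_roots:
  fixes f :: "complex \<Rightarrow> complex"
  assumes "f holomorphic_on UNIV" "f z0 \<noteq> 0" "finite S" "0 \<notin> S"
  shows "\<exists>q. q holomorphic_on UNIV \<and> (\<forall>a\<in>S. q a \<noteq> 0) \<and>
           (\<forall>w. f w = (\<Prod>a\<in>S. (1 - w / a) ^ nat (zorder f a)) * q w)"
  using assms(3,4)
proof (induction S rule: finite_induct)
  case empty
  then show ?case using assms by (intro exI[of _ f]) auto
next
  case (insert a S)
  then obtain q where q: "q holomorphic_on UNIV" "\<forall>a\<in>S. q a \<noteq> 0"
     "\<And>w. f w = (\<Prod>a\<in>S. (1 - w / a) ^ nat (zorder f a)) * q w" by auto
  define P where "P = (\<lambda>w. \<Prod>a\<in>S. (1 - w / a) ^ nat (zorder f a))"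
  have "q z0 \<noteq> 0" using assms(2) q(3)[of z0] by auto
  then obtain q' where q': "q' holomorphic_on UNIV" "q' a \<noteq> 0"
      "\<And>w. q w = (w - a) ^ nat (zorder q a) * q' w"
    using entire_factor_root[OF q(1), of z0 a] by blast
  define k where "k = nat (zorder q a)"
  have fq: "f w = P w * (w - a) ^ k * q' w" for w
    using q(3)[of w] q'(3)[of w] by (simp add: P_def k_def)
  have Pa: "P a \<noteq> 0" using insert by (auto simp: P_def)
  \<comment> \<open>The factors removed earlier do not vanish at \<open>a\<close>, so the order of
    \<open>q\<close> at \<open>a\<close> is that of \<open>f\<close>.\<close>
  have "zorder f a = int k"
  proof (rule zorder_eqI[of UNIV a "\<lambda>w. P w * q' w"])
    show "(\<lambda>w. P w * q' w) holomorphic_on UNIV"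
      using insert.prems unfolding P_def by (intro holomorphic_intros q') auto
  qed (use Pa q' fq in \<open>auto simp: mult_ac\<close>)
  hence k: "nat (zorder f a) = k" by simp
  have "a \<noteq> 0" using insert by auto
  hence lin: "w - a = (- a) * (1 - w / a)" for w by (simp add: field_simps)
  show ?case
  proof (intro exI[of _ "\<lambda>w. (- a) ^ k * q' w"] conjI ballI allI)
    fix b assume "b \<in> insert a S"
    moreover have "q' b \<noteq> 0" if "b \<in> S" using q(2) q'(3)[of b] that by auto
    ultimately show "(- a) ^ k * q' b \<noteq> 0" using q'(2) \<open>a \<noteq> 0\<close> by auto
  next
    fix w
    have "f w = P w * ((- a) * (1 - w / a)) ^ k * q' w"
      unfolding lin[symmetric] by (rule fq)
    also have "\<dots> = (1 - w / a) ^ k * P w * ((- a) ^ k * q' w)"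
      by (simp only: power_mult_distrib mult_ac)
    finally show "f w = (\<Prod>a\<in>insert a S. (1 - w / a) ^ nat (zorder f a)) * ((- a) ^ k * q' w)"
      using insert by (simp add: P_def k)
  qed (intro holomorphic_intros q')
qed

text \<open>The map \<open>l / (2 * M - l)\<close> sends the half-plane \<open>Re l < M\<close> into
  the unit disc and fixes 0, so the Schwarz lemma applies to its composition with \<open>L\<close>.
  On \<open>norm w \<le> R / 2\<close> it gives
  \<open>2 * norm (L w) \<le> norm (2 * M - L w)\<close>, whence the bound.\<close>

lemma Borel_Caratheodory:
  fixes L :: "complex \<Rightarrow> complex"
  assumes hol: "L holomorphic_on ball 0 R" and "R > 0" and L0: "L 0 = 0"
    and Re: "\<And>w. norm w < R \<Longrightarrow> Re (L w) < M" and w: "norm w \<le> R / 2"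
  shows "norm (L w) \<le> 2 * M"
proof -
  have M: "M > 0" using Re[of 0] L0 \<open>R > 0\<close> by simp
  have Re': "Re (L (of_real R * u)) < M" if "norm u < 1" for u
    using Re[of "of_real R * u"] that \<open>R > 0\<close> by (simp add: norm_mult)
  have nz: "2 * of_real M - L (of_real R * u) \<noteq> 0" if "norm u < 1" for u
  proof
    assume "2 * of_real M - L (of_real R * u) = 0"
    hence "Re (L (of_real R * u)) = 2 * M" by (simp add: complex_eq_iff)
    with Re'[OF that] M show False by simp
  qed
  define \<psi> where "\<psi> = (\<lambda>u. L (of_real R * u) / (2 * of_real M - L (of_real R * u)))"
  have holL: "(\<lambda>u. L (of_real R * u)) holomorphic_on ball 0 1"
    by (rule holomorphic_on_compose_gen[OF _ hol, unfolded o_def])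
       (use \<open>R > 0\<close> in \<open>auto intro!: holomorphic_intros simp: norm_mult\<close>)
  have "norm (\<psi> (w / of_real R)) \<le> norm (w / of_real R)"
  proof (rule Schwarz_Lemma(1))
    show "\<psi> holomorphic_on ball 0 1"
      unfolding \<psi>_def using nz by (intro holomorphic_intros holL) auto
    show "\<psi> 0 = 0" by (simp add: \<psi>_def L0)
    show "norm (w / of_real R) < 1" using w \<open>R > 0\<close> by (simp add: norm_divide)
    fix u :: complex assume u: "norm u < 1"
    let ?l = "L (of_real R * u)"
    \<comment> \<open>The difference of the two squares is
      \<open>4 * M * (M - Re ?l)\<close>.\<close>
    have "(norm ?l)\<^sup>2 < (norm (2 * of_real M - ?l))\<^sup>2"
      using mult_strict_left_mono[OF Re'[OF u] M]
      unfolding cmod_power2 by (simp add: power2_eq_square algebra_simps)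
    hence "norm ?l < norm (2 * of_real M - ?l)" by (rule power2_less_imp_less) simp
    thus "norm (\<psi> u) < 1" using nz[OF u] by (simp add: \<psi>_def norm_divide)
  qed
  also have "norm (w / of_real R) \<le> 1 / 2" using w \<open>R > 0\<close> by (simp add: norm_divide field_simps)
  finally have "norm (L w) / norm (2 * of_real M - L w) \<le> 1 / 2"
    using \<open>R > 0\<close> by (simp add: \<psi>_def norm_divide)
  moreover have "2 * of_real M - L w \<noteq> 0"
    using nz[of "w / of_real R"] w \<open>R > 0\<close> by (simp add: norm_divide)
  ultimately have "2 * norm (L w) \<le> norm (2 * of_real M - L w)"
    by (simp add: divide_simps)
  also have "\<dots> \<le> 2 * M + norm (L w)" using norm_triangle_ineq4[of "2 * of_real M" "L w"] M by simp
  finally show ?thesis by simp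
qed

text \<open>A zero-free \<open>q\<close> on a disc has a logarithm. Normalised to vanish at 0, it
  has real part below \<open>M\<close>; the \<open>+ 1\<close> makes this strict, as
  \<open>Borel_Caratheodory\<close> requires. Cauchy's estimates on discs of radius
  \<open>R / 4\<close> around \<open>w\<close> and \<open>R / 2\<close> around 0 give the two
  constants.\<close>

lemma logderiv_bounds:
  fixes q :: "complex \<Rightarrow> complex"
  assumes hol: "q holomorphic_on ball 0 R" and R: "R > 0"
    and nz: "\<And>w. norm w < R \<Longrightarrow> q w \<noteq> 0"
    and bd: "\<And>w. norm w < R \<Longrightarrow> norm (q w) \<le> K"
  defines "M \<equiv> ln (K / norm (q 0)) + 1"
  shows "norm w \<le> R / 4 \<Longrightarrow> norm (deriv q w / q w) \<le> 8 * M / R"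
    and "norm (deriv (\<lambda>w. deriv q w / q w) 0) \<le> 16 * M / R\<^sup>2"
proof -
  obtain L0 where L0: "L0 holomorphic_on ball 0 R" "\<And>z. z \<in> ball 0 R \<Longrightarrow> q z = exp (L0 z)"
    using contractible_imp_holomorphic_log[OF hol] nz convex_imp_contractible[OF convex_ball]
    by (metis mem_ball_0)
  define L where "L = (\<lambda>z. L0 z - L0 0)"
  have holL: "L holomorphic_on ball 0 R" unfolding L_def by (intro holomorphic_intros L0)
  have q0: "q 0 \<noteq> 0" using nz R by simp
  have qL: "q z = q 0 * exp (L z)" if "norm z < R" for z
    using L0(2)[of z] L0(2)[of 0] that R by (simp add: L_def exp_diff)
  have ReL: "Re (L z) < M" if z: "norm z < R" for z
  proof -
    have "norm (q 0) * exp (Re (L z)) \<le> K" using bd[OF z] qL[OF z] by (simp add: norm_mult)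
    hence le: "exp (Re (L z)) \<le> K / norm (q 0)" using q0 by (simp add: field_simps)
    moreover have "0 < exp (Re (L z))" by simp
    ultimately have "Re (L z) \<le> ln (K / norm (q 0))"
      by (metis ln_exp ln_mono)
    thus ?thesis by (simp add: M_def)
  qed
  have Lb: "norm (L z) \<le> 2 * M" if "norm z \<le> R / 2" for z
    using Borel_Caratheodory[OF holL R _ ReL that] by (simp add: L_def)
  have dL: "deriv q z / q z = deriv L z" if z: "norm z < R" for z
  proof -
    have "(L has_field_derivative deriv L z) (at z)"
      using holomorphic_derivI[OF holL] z by auto
    hence "((\<lambda>z. q 0 * exp (L z)) has_field_derivative q 0 * exp (L z) * deriv L z) (at z)"
      by (auto intro!: derivative_eq_intros)
    moreover have "eventually (\<lambda>y. q 0 * exp (L y) = q y) (nhds z)"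
      using eventually_nhds_in_open[of "ball 0 R" z] z by (auto elim!: eventually_mono simp: qL)
    ultimately have "(q has_field_derivative q z * deriv L z) (at z)"
      using qL[OF z] by (subst (asm) DERIV_cong_ev[OF refl _ refl]) auto
    thus ?thesis using nz[OF z] by (simp add: DERIV_imp_deriv)
  qed
  have cont: "continuous_on (ball 0 R) L" using holL by (rule holomorphic_on_imp_continuous_on)
  show "norm (deriv q w / q w) \<le> 8 * M / R" if w: "norm w \<le> R / 4"
  proof -
    have sub: "norm z \<le> R / 2" if "norm (w - z) \<le> R / 4" for z
      using w that norm_triangle_ineq2[of z w] by (simp add: norm_minus_commute)
    have "norm ((deriv ^^ 1) L w) \<le> fact 1 * (2 * M) / (R / 4) ^ 1"
    proof (rule Cauchy_inequality)
      show "L holomorphic_on ball w (R / 4)"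
        by (rule holomorphic_on_subset[OF holL])
           (use R in \<open>auto intro!: le_less_trans[OF sub] simp: dist_norm\<close>)
      show "continuous_on (cball w (R / 4)) L"
        by (rule continuous_on_subset[OF cont])
           (use R in \<open>auto intro!: le_less_trans[OF sub] simp: dist_norm\<close>)
    qed (use R Lb sub in auto)
    moreover have "norm w < R" using w R by linarith
    ultimately show ?thesis using dL[of w] by simp
  qed
  have "norm ((deriv ^^ 2) L 0) \<le> fact 2 * (2 * M) / (R / 2) ^ 2"
  proof (rule Cauchy_inequality)
    show "L holomorphic_on ball 0 (R / 2)"
      by (rule holomorphic_on_subset[OF holL]) (use R in auto)
    show "continuous_on (cball 0 (R / 2)) L"
      by (rule continuous_on_subset[OF cont]) (use R in auto)
  qed (use R Lb in auto)
  moreover have "deriv (\<lambda>w. deriv q w / q w) 0 = deriv (deriv L) 0"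
  proof (rule deriv_cong_ev)
    show "eventually (\<lambda>y. deriv q y / q y = deriv L y) (nhds 0)"
      using eventually_nhds_in_open[of "ball 0 R" 0] R by (auto elim!: eventually_mono simp: dL)
  qed simp
  ultimately show "norm (deriv (\<lambda>w. deriv q w / q w) 0) \<le> 16 * M / R\<^sup>2"
    by (simp add: numeral_2_eq_2 power2_eq_square)
qed

lemma logderiv_prod:
  fixes f :: "'b \<Rightarrow> complex \<Rightarrow> complex"
  assumes "finite S" "\<And>a. a \<in> S \<Longrightarrow> f a field_differentiable at w" "\<And>a. a \<in> S \<Longrightarrow> f a w \<noteq> 0"
  shows "deriv (\<lambda>w. \<Prod>a\<in>S. f a w) w / (\<Prod>a\<in>S. f a w) = (\<Sum>a\<in>S. deriv (f a) w / f a w)"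
proof -
  have "((\<lambda>w. \<Prod>a\<in>S. f a w) has_field_derivative
          (\<Prod>a\<in>S. f a w) * (\<Sum>a\<in>S. deriv (f a) w / f a w)) (at w)"
    using assms
    by (intro has_field_derivative_prod') (auto simp: field_differentiable_derivI)
  moreover have "(\<Prod>a\<in>S. f a w) \<noteq> 0" using assms by simp
  ultimately show ?thesis by (simp add: DERIV_imp_deriv)
qed

lemma logderiv_mult:
  fixes f g :: "complex \<Rightarrow> complex"
  assumes "f field_differentiable at w" "g field_differentiable at w" "f w \<noteq> 0" "g w \<noteq> 0"
  shows "deriv (\<lambda>w. f w * g w) w / (f w * g w) = deriv f w / f w + deriv g w / g w"
  using assms by (simp add: field_simps)

lemma logderiv_linear_power:
  fixes a w :: complex
  assumes "a \<noteq> 0" "w \<noteq> a"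
  shows "deriv (\<lambda>w. (1 - w / a) ^ n) w / (1 - w / a) ^ n = of_nat n / (w - a)"
proof (cases n)
  case (Suc m)
  have nz: "1 - w / a \<noteq> 0" using assms by (simp add: field_simps)
  have "((\<lambda>w. (1 - w / a) ^ n) has_field_derivative of_nat n * (1 - w / a) ^ m * (- 1 / a)) (at w)"
  proof -
    have "((\<lambda>w. 1 - w / a) has_field_derivative - 1 / a) (at w)"
      using assms by (auto intro!: derivative_eq_intros)
    from DERIV_power[OF this, of n] show ?thesis by (simp add: Suc mult_ac)
  qed
  hence "deriv (\<lambda>w. (1 - w / a) ^ n) w = of_nat n * (1 - w / a) ^ m * (- 1 / a)"
    by (rule DERIV_imp_deriv)
  hence "deriv (\<lambda>w. (1 - w / a) ^ n) w / (1 - w / a) ^ n = of_nat n * (- 1 / a) / (1 - w / a)"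
    using nz by (simp add: Suc)
  also have "\<dots> = of_nat n / (w - a)"
    using assms nz by (simp add: divide_simps) (simp add: algebra_simps)
  finally show ?thesis .
qed simp

section \<open>The logarithmic derivative as a sum over the roots\<close>

locale small_entire =
  fixes f :: "complex \<Rightarrow> complex" and C A :: real
  assumes hol: "f holomorphic_on UNIV" and f0: "f 0 \<noteq> 0"
    and growth: "\<And>w. norm (f w) \<le> C * exp (A * sqrt (norm w))" and A: "A \<ge> 0"
begin

definition Z :: "real \<Rightarrow> complex set" where "Z R = {a. f a = 0 \<and> norm a \<le> R}"

definition mult :: "complex \<Rightarrow> nat" where "mult a = nat (zorder f a)"

lemma zorder_pos: "zorder f a > 0" if "f a = 0"
  using zorder_exist_zero[of f UNIV a] hol f0 that by (metis UNIV_I connected_UNIV open_UNIV)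

lemma C: "C > 0"
  using growth[of 0] f0 zero_less_norm_iff[of "f 0"] by (simp del: zero_less_norm_iff)

lemma finite_Z: "finite (Z R)"
proof (cases "\<exists>a. f a = 0")
  case True
  hence "\<not> f constant_on UNIV" using f0 by (metis constant_on_def UNIV_I)
  hence "finite {a\<in>cball 0 R. f a = 0}"
    using holomorphic_compact_finite_zeros[OF hol open_UNIV connected_UNIV compact_cball] by blast
  moreover have "Z R = {a\<in>cball 0 R. f a = 0}" by (auto simp: Z_def)
  ultimately show ?thesis by simp
qed (simp add: Z_def)

text \<open>This is the \<open>M\<close> of \<open>logderiv_bounds\<close> for \<open>f\<close>
  divided by its root factors in the disc of radius \<open>R\<close>, with the growth bound taken on
  the circle of radius \<open>2 * R\<close>.\<close>

definition M :: "real \<Rightarrow> real" where "M R = ln C + A * sqrt (2 * R) - ln (norm (f 0)) + 1"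

text \<open>Let \<open>q\<close> be \<open>f\<close> divided by the factors \<open>1 - w / a\<close>
  of its roots in the disc of radius \<open>R\<close>. The differences to be estimated are
  \<open>q' / q\<close> and, at 0, its derivative, so \<open>logderiv_bounds\<close> applies once
  \<open>q\<close> is bounded in terms of the growth of \<open>f\<close>.\<close>

lemma logderiv_approx:
  assumes R: "R > 0"
  shows "norm w \<le> R / 4 \<Longrightarrow> f w \<noteq> 0 \<Longrightarrow>
           norm (deriv f w / f w - (\<Sum>a\<in>Z R. of_nat (mult a) / (w - a))) \<le> 8 * M R / R"
    and "norm (deriv (deriv f) 0 / f 0 - (deriv f 0 / f 0)\<^sup>2 + (\<Sum>a\<in>Z R. of_nat (mult a) / a\<^sup>2))
           \<le> 16 * M R / R\<^sup>2"
proof -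
  define P where "P = (\<lambda>w. \<Prod>a\<in>Z R. (1 - w / a) ^ mult a)"
  have "0 \<notin> Z R" using f0 by (auto simp: Z_def)
  then obtain q where q: "q holomorphic_on UNIV" "\<And>a. a \<in> Z R \<Longrightarrow> q a \<noteq> 0"
      "\<And>w. f w = P w * q w"
    using entire_factor_finite_roots[OF hol f0 finite_Z] unfolding P_def mult_def by metis
  have a0: "a \<noteq> 0" if "a \<in> Z R" for a using that \<open>0 \<notin> Z R\<close> by auto
  have P0: "P 0 = 1" by (simp add: P_def)
  have holq: "q holomorphic_on S" for S using q(1) holomorphic_on_subset by blast
  have holP: "P holomorphic_on S" for S
    unfolding P_def using a0 by (intro holomorphic_intros) auto
  have nz: "q w \<noteq> 0" if "norm w < R" for w
    using q(2)[of w] q(3)[of w] that by (cases "w \<in> Z R") (auto simp: Z_def)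
  \<comment> \<open>On the circle of radius \<open>2 * R\<close> every removed root satisfies
    \<open>norm (z / a) \<ge> 2\<close>, so every removed factor has norm at least 1 and
    \<open>q\<close> is no larger than \<open>f\<close>. The maximum modulus principle carries the
    bound inside.\<close>
  have bd: "norm (q w) \<le> C * exp (A * sqrt (2 * R))" if "norm w < R" for w
  proof (rule maximum_modulus_frontier[of q "cball 0 (2 * R)"])
    show "continuous_on (closure (cball 0 (2 * R))) q"
      using holq by (rule holomorphic_on_imp_continuous_on)
    fix z assume "z \<in> frontier (cball (0::complex) (2 * R))"
    hence z: "norm z = 2 * R" using R by simp
    have ge: "norm (1 - z / a) \<ge> 1" if "a \<in> Z R" for a
    proof -
      have "norm a \<le> R" "norm a > 0" using that a0[OF that] by (auto simp: Z_def)
      hence "norm (z / a) \<ge> 2" using z by (simp add: norm_divide field_simps)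
      thus ?thesis using norm_triangle_ineq2[of "z / a" 1] by (simp add: norm_minus_commute)
    qed
    have "norm (P z) \<ge> 1"
      unfolding P_def prod_norm[symmetric] norm_power
      by (intro prod_ge_1 one_le_power ge)
    hence "norm (q z) * 1 \<le> norm (q z) * norm (P z)"
      by (intro mult_left_mono) auto
    also have "\<dots> = norm (f z)" using q(3)[of z] by (simp add: norm_mult)
    finally show "norm (q z) \<le> C * exp (A * sqrt (2 * R))" using growth[of z] z by simp
  qed (use that R holq in auto)
  have M: "ln (C * exp (A * sqrt (2 * R)) / norm (q 0)) + 1 = M R"
    using q(3)[of 0] P0 f0 C by (simp add: M_def ln_mult ln_div)
  have eq: "deriv q w / q w = deriv f w / f w - (\<Sum>a\<in>Z R. of_nat (mult a) / (w - a))"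
    if w: "f w \<noteq> 0" for w
  proof -
    have wa: "w \<noteq> a" if "a \<in> Z R" for a using that w by (auto simp: Z_def)
    have nz1: "1 - w / a \<noteq> 0" if "a \<in> Z R" for a
      using wa[OF that] a0[OF that] by (simp add: field_simps)
    have fd: "(\<lambda>w. (1 - w / a) ^ mult a) field_differentiable at w" if "a \<in> Z R" for a
      by (rule holomorphic_on_imp_differentiable_at[of _ UNIV])
         (use a0[OF that] in \<open>auto intro!: holomorphic_intros\<close>)
    have P: "deriv P w / P w = (\<Sum>a\<in>Z R. of_nat (mult a) / (w - a))"
      unfolding P_def using nz1 fd a0 wa
      by (subst logderiv_prod) (auto intro!: sum.cong logderiv_linear_power finite_Z)
    have "f = (\<lambda>w. P w * q w)" using q(3) by blast
    hence "deriv f w / f w = deriv P w / P w + deriv q w / q w"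
      using logderiv_mult[of P w q] w holomorphic_on_imp_differentiable_at[of _ UNIV w] holP holq
      by auto
    with P show ?thesis by simp
  qed
  show "norm (deriv f w / f w - (\<Sum>a\<in>Z R. of_nat (mult a) / (w - a))) \<le> 8 * M R / R"
    if "norm w \<le> R / 4" "f w \<noteq> 0"
    using logderiv_bounds(1)[OF holq R nz bd that(1)] eq[OF that(2)] M by simp
  \<comment> \<open>Differentiating \<open>eq\<close> at 0 requires the identity on a whole
    neighbourhood of 0.\<close>
  have "eventually (\<lambda>w. f w \<noteq> 0) (nhds 0)"
  proof -
    have "continuous_on UNIV f" using hol by (rule holomorphic_on_imp_continuous_on)
    hence "open {w. f w \<noteq> 0}" using open_Collect_neq[of f "\<lambda>_. 0"] by simp
    from eventually_nhds_in_open[OF this, of 0] f0 show ?thesis by simp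
  qed
  hence ev: "eventually (\<lambda>w. deriv q w / q w = deriv f w / f w - (\<Sum>a\<in>Z R. of_nat (mult a) / (w - a))) (nhds 0)"
    by eventually_elim (rule eq)
  have "((\<lambda>w. deriv f w / f w - (\<Sum>a\<in>Z R. of_nat (mult a) / (w - a))) has_field_derivative
      (deriv (deriv f) 0 * f 0 - deriv f 0 * deriv f 0) / (f 0 * f 0)
       - (\<Sum>a\<in>Z R. - (of_nat (mult a) / a\<^sup>2))) (at 0)"
  proof (intro DERIV_diff DERIV_divide DERIV_sum)
    show "(f has_field_derivative deriv f 0) (at 0)"
      using holomorphic_derivI[OF hol open_UNIV UNIV_I] .
    show "(deriv f has_field_derivative deriv (deriv f) 0) (at 0)"
      using holomorphic_derivI[OF holomorphic_deriv[OF hol open_UNIV] open_UNIV UNIV_I] .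
    fix a assume "a \<in> Z R"
    thus "((\<lambda>w. of_nat (mult a) / (w - a)) has_field_derivative - (of_nat (mult a) / a\<^sup>2)) (at 0)"
      using a0[of a] by (auto intro!: derivative_eq_intros simp: power2_eq_square)
  qed (use f0 in auto)
  hence "deriv (\<lambda>w. deriv q w / q w) 0 = (deriv (deriv f) 0 * f 0 - deriv f 0 * deriv f 0) / (f 0 * f 0)
       - (\<Sum>a\<in>Z R. - (of_nat (mult a) / a\<^sup>2))"
    using deriv_cong_ev[OF ev refl] by (simp add: DERIV_imp_deriv)
  also have "\<dots> = deriv (deriv f) 0 / f 0 - (deriv f 0 / f 0)\<^sup>2 + (\<Sum>a\<in>Z R. of_nat (mult a) / a\<^sup>2)"
    using f0 by (simp add: sum_negf power2_eq_square field_simps)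
  finally show "norm (deriv (deriv f) 0 / f 0 - (deriv f 0 / f 0)\<^sup>2 + (\<Sum>a\<in>Z R. of_nat (mult a) / a\<^sup>2))
           \<le> 16 * M R / R\<^sup>2"
    using logderiv_bounds(2)[OF holq R nz bd] M by simp
qed

lemma M_asymp: "((\<lambda>R. 8 * M R / R) \<longlongrightarrow> 0) at_top" "((\<lambda>R. 16 * M R / R\<^sup>2) \<longlongrightarrow> 0) at_top"
  unfolding M_def by real_asymp+

text \<open>\<open>M R\<close> grows only like the square root of \<open>R\<close>, so the error
  \<open>8 * M R / R\<close> tends to 0; the estimate applies to \<open>w\<close> as soon as
  \<open>R \<ge> 4 * norm w\<close>.\<close>

lemma logderiv_tendsto:
  assumes "f w \<noteq> 0"
  shows "((\<lambda>R. \<Sum>a\<in>Z R. of_nat (mult a) / (w - a)) \<longlongrightarrow> deriv f w / f w) at_top"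
proof -
  have "((\<lambda>R. deriv f w / f w - (\<Sum>a\<in>Z R. of_nat (mult a) / (w - a))) \<longlongrightarrow> 0) at_top"
  proof (rule Lim_null_comparison[OF _ M_asymp(1)])
    show "\<forall>\<^sub>F R in at_top. norm (deriv f w / f w - (\<Sum>a\<in>Z R. of_nat (mult a) / (w - a))) \<le> 8 * M R / R"
      using eventually_ge_at_top[of "4 * norm w"] eventually_gt_at_top[of 0]
      by eventually_elim (use logderiv_approx(1) assms in auto)
  qed
  from tendsto_diff[OF tendsto_const[of "deriv f w / f w"] this] show ?thesis by simp
qed

lemma sum_inverse_tendsto: "((\<lambda>R. \<Sum>a\<in>Z R. of_nat (mult a) / a) \<longlongrightarrow> - deriv f 0 / f 0) at_top"
  using tendsto_minus[OF logderiv_tendsto[OF f0]] by (simp add: sum_negf)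

text \<open>This is the derivative at 0 of the expansion of \<open>f' / f\<close>, obtained from the
  second estimate of \<open>logderiv_approx\<close> and not by differentiating a limit.\<close>

lemma sum_inverse_square_tendsto:
  "((\<lambda>R. \<Sum>a\<in>Z R. of_nat (mult a) / a\<^sup>2) \<longlongrightarrow> (deriv f 0 / f 0)\<^sup>2 - deriv (deriv f) 0 / f 0) at_top"
proof -
  have "((\<lambda>R. deriv (deriv f) 0 / f 0 - (deriv f 0 / f 0)\<^sup>2 + (\<Sum>a\<in>Z R. of_nat (mult a) / a\<^sup>2))
           \<longlongrightarrow> 0) at_top"
    by (rule Lim_null_comparison[OF _ M_asymp(2)])
       (use eventually_gt_at_top[of 0] in eventually_elim, rule logderiv_approx(2))
  from tendsto_diff[OF this tendsto_const[of "deriv (deriv f) 0 / f 0 - (deriv f 0 / f 0)\<^sup>2"]]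
  show ?thesis by simp
qed

end

context small_entire
begin

text \<open>With finitely many roots the truncated sums are eventually constant, so
  \<open>f' / f\<close> equals the logarithmic derivative of the root product \<open>P\<close>. The
  quotient \<open>q\<close> then has derivative 0 and \<open>f\<close> is a polynomial.\<close>

lemma finite_roots_imp_poly_growth:
  assumes fin: "finite {a. f a = 0}"
  shows "\<exists>K n. \<forall>w. norm w \<ge> 1 \<longrightarrow> norm (f w) \<le> K * norm w ^ n"
proof -
  define S where "S = {a. f a = 0}"
  have "0 \<notin> S" "finite S" using f0 fin by (auto simp: S_def)
  define P where "P = (\<lambda>w. \<Prod>a\<in>S. (1 - w / a) ^ mult a)"
  obtain q where q: "q holomorphic_on UNIV" "\<And>a. a \<in> S \<Longrightarrow> q a \<noteq> 0" "\<And>w. f w = P w * q w"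
    using entire_factor_finite_roots[OF hol f0 \<open>finite S\<close> \<open>0 \<notin> S\<close>] unfolding P_def mult_def by metis
  have "eventually (\<lambda>R. Z R = S) at_top"
  proof -
    obtain B where "\<forall>a\<in>S. norm a \<le> B"
      using finite_imp_bounded[OF \<open>finite S\<close>] unfolding bounded_iff by blast
    hence "Z R = S" if "R \<ge> B" for R using that by (force simp: Z_def S_def)
    thus ?thesis by (rule eventually_at_top_linorderI)
  qed
  hence lim: "((\<lambda>R. \<Sum>a\<in>Z R. of_nat (mult a) / (w - a)) \<longlongrightarrow> (\<Sum>a\<in>S. of_nat (mult a) / (w - a))) at_top" for w
    by (intro tendsto_eventually) (auto elim!: eventually_mono)
  have dq: "(q has_field_derivative 0) (at w)" if w: "w \<notin> S" for w
  proof -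
    have fw: "f w \<noteq> 0" using w by (simp add: S_def)
    have a0: "a \<noteq> 0" and wa: "w \<noteq> a" if "a \<in> S" for a using that w \<open>0 \<notin> S\<close> by auto
    have nz: "1 - w / a \<noteq> 0" if "a \<in> S" for a
      using wa[OF that] a0[OF that] by (simp add: field_simps)
    have fd: "(\<lambda>w. (1 - w / a) ^ mult a) field_differentiable at w" if "a \<in> S" for a
      by (rule holomorphic_on_imp_differentiable_at[of _ UNIV])
         (use a0[OF that] in \<open>auto intro!: holomorphic_intros\<close>)
    have "deriv P w / P w = (\<Sum>a\<in>S. of_nat (mult a) / (w - a))"
      unfolding P_def using nz fd a0 wa
      by (subst logderiv_prod) (auto intro!: sum.cong logderiv_linear_power \<open>finite S\<close>)
    also have "\<dots> = deriv f w / f w"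
      using tendsto_unique[OF _ lim logderiv_tendsto[OF fw]] by simp
    also have "\<dots> = deriv P w / P w + deriv q w / q w"
    proof -
      have "f = (\<lambda>w. P w * q w)" using q(3) by blast
      moreover have "P holomorphic_on UNIV"
        unfolding P_def using a0 by (intro holomorphic_intros) auto
      ultimately show ?thesis
        using logderiv_mult[of P w q] fw holomorphic_on_imp_differentiable_at[of _ UNIV w] q(1)
        by auto
    qed
    finally have "deriv q w = 0" using fw q(3)[of w] by simp
    thus ?thesis using holomorphic_derivI[OF q(1) open_UNIV UNIV_I, of w] by simp
  qed
  \<comment> \<open>The derivative of \<open>q\<close> is known to vanish only off the finite set
    \<open>S\<close>; continuity of \<open>q\<close> bridges these points.\<close>
  obtain c where c: "\<And>w. q w = c"
    using DERIV_zero_connected_constant[OF connected_UNIV open_UNIV \<open>finite S\<close>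
            holomorphic_on_imp_continuous_on[OF q(1)]] dq by auto
  show ?thesis
  proof (intro exI allI impI)
    fix w :: complex assume w: "norm w \<ge> 1"
    have "norm (1 - w / a) \<le> (1 + 1 / norm a) * norm w" for a
    proof -
      have "norm (1 - w / a) \<le> 1 + norm w / norm a"
        using norm_triangle_ineq4[of 1 "w / a"] by (simp add: norm_divide)
      also have "\<dots> \<le> norm w + norm w / norm a" using w by simp
      finally show ?thesis by (simp add: field_simps)
    qed
    hence "norm (P w) \<le> (\<Prod>a\<in>S. ((1 + 1 / norm a) * norm w) ^ mult a)"
      unfolding P_def prod_norm[symmetric] norm_power
      by (intro prod_mono conjI power_mono) auto
    also have "\<dots> = (\<Prod>a\<in>S. (1 + 1 / norm a) ^ mult a) * norm w ^ (\<Sum>a\<in>S. mult a)"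
      by (simp add: power_mult_distrib prod.distrib power_sum)
    finally show "norm (f w) \<le> (norm c * (\<Prod>a\<in>S. (1 + 1 / norm a) ^ mult a)) * norm w ^ (\<Sum>a\<in>S. mult a)"
      using q(3)[of w] c by (simp add: norm_mult mult_ac mult_left_mono)
  qed
qed

end

section \<open>Alternating power series with positive roots\<close>

text \<open>The signs are kept outside \<open>d\<close>, so that the coefficient sequences can be
  assumed positive.\<close>

definition alt_series :: "(nat \<Rightarrow> real) \<Rightarrow> complex \<Rightarrow> complex" where
  "alt_series d w = (\<Sum>m. of_real ((-1) ^ m * d m) * w ^ m)"

text \<open>The factorial of \<open>2 * m\<close> bounds the series by
  \<open>C * cosh (sqrt (B * norm w))\<close>, which is the growth that \<open>small_entire\<close>
  asks for.\<close>

locale pos_coeff_series =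
  fixes d :: "nat \<Rightarrow> real" and C B :: real
  assumes d_pos: "\<And>m. d m > 0" and d_le: "\<And>m. d m \<le> C * B ^ m / fact (2 * m)"
    and B: "B > 0"
begin

abbreviation G where "G \<equiv> alt_series d"

definition c :: "nat \<Rightarrow> complex" where "c m = of_real ((-1) ^ m * d m)"

lemma C_pos: "C > 0"
  using d_pos[of 0] d_le[of 0] by simp

lemma G_eq: "G w = (\<Sum>m. c m * w ^ m)"
  by (simp add: alt_series_def c_def)

lemma norm_c: "norm (c m) = d m"
  using d_pos[of m] by (simp add: c_def norm_mult norm_power)

lemma norm_term_le: "norm (c m * w ^ m) \<le> C * (sqrt (B * norm w) ^ (2 * m) / fact (2 * m))"
proof -
  have "norm (c m * w ^ m) = d m * norm w ^ m" by (simp add: norm_mult norm_c norm_power)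
  also have "\<dots> \<le> C * B ^ m / fact (2 * m) * norm w ^ m" by (intro mult_right_mono d_le) auto
  also have "B ^ m * norm w ^ m = sqrt (B * norm w) ^ (2 * m)"
    using B by (simp add: power_mult power_mult_distrib)
  hence "C * B ^ m / fact (2 * m) * norm w ^ m = C * (sqrt (B * norm w) ^ (2 * m) / fact (2 * m))"
    by (simp add: field_simps)
  finally show ?thesis .
qed

lemma
  fixes x :: real assumes "x \<ge> 0"
  shows summable_even_exp: "summable (\<lambda>m. x ^ (2 * m) / fact (2 * m))"
    and suminf_even_exp_le: "(\<Sum>m. x ^ (2 * m) / fact (2 * m)) \<le> exp x"
proof -
  have e: "(\<lambda>n. x ^ n / fact n) sums exp x"
    using exp_converges[of x] by (simp add: divide_inverse mult.commute)
  have inj: "inj (\<lambda>m::nat. 2 * m)" by (auto intro: injI)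
  show "summable (\<lambda>m. x ^ (2 * m) / fact (2 * m))"
    using summable_reindex[OF sums_summable[OF e] inj] assms by (simp add: o_def)
  show "(\<Sum>m. x ^ (2 * m) / fact (2 * m)) \<le> exp x"
    using suminf_reindex_mono[OF sums_summable[OF e] inj] assms sums_unique[OF e] by (simp add: o_def)
qed

lemma summable_norm_G: "summable (\<lambda>m. norm (c m * w ^ m))"
proof (rule summable_comparison_test')
  show "summable (\<lambda>m. C * (sqrt (B * norm w) ^ (2 * m) / fact (2 * m)))"
    using B by (intro summable_mult summable_even_exp) auto
  show "norm (norm (c m * w ^ m)) \<le> C * (sqrt (B * norm w) ^ (2 * m) / fact (2 * m))" for m
    using norm_term_le[of m w] by simp
qed

lemma summable_G: "summable (\<lambda>m. c m * w ^ m)"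
  using summable_norm_G by (rule summable_norm_cancel)

lemma norm_G_le: "norm (G w) \<le> C * exp (sqrt B * sqrt (norm w))"
proof -
  let ?x = "sqrt (B * norm w)"
  have x: "?x \<ge> 0" using B by simp
  have "norm (G w) \<le> (\<Sum>m. norm (c m * w ^ m))"
    unfolding G_eq by (rule summable_norm[OF summable_norm_G])
  also have "\<dots> \<le> (\<Sum>m. C * (?x ^ (2 * m) / fact (2 * m)))"
    by (intro suminf_le norm_term_le summable_norm_G summable_mult summable_even_exp x)
  also have "\<dots> = C * (\<Sum>m. ?x ^ (2 * m) / fact (2 * m))"
    by (intro suminf_mult summable_even_exp x)
  also have "\<dots> \<le> C * exp ?x" using C_pos by (intro mult_left_mono suminf_even_exp_le x) auto
  finally show ?thesis by (simp add: real_sqrt_mult)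
qed

lemma summable_diffs: "summable (\<lambda>m. diffs c m * w ^ m)"
  using termdiff_converges_all[OF summable_G] .

lemma G_deriv: "(G has_field_derivative (\<Sum>m. diffs c m * w ^ m)) (at w)"
  unfolding G_eq[abs_def] by (rule termdiffs_strong_converges_everywhere[OF summable_G])

lemma G_holomorphic: "G holomorphic_on S"
  using G_deriv by (auto simp: holomorphic_on_def field_differentiable_def intro: has_field_derivative_at_within)

lemma G_values: "G 0 = of_real (d 0)" "deriv G 0 = - of_real (d 1)" "deriv (deriv G) 0 = of_real (2 * d 2)"
proof -
  have dG: "deriv G = (\<lambda>w. \<Sum>m. diffs c m * w ^ m)" using G_deriv by (auto intro!: DERIV_imp_deriv)
  have "(deriv G has_field_derivative (\<Sum>m. diffs (diffs c) m * 0 ^ m)) (at 0)"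
    unfolding dG by (rule termdiffs_strong_converges_everywhere[OF summable_diffs])
  thus "deriv (deriv G) 0 = of_real (2 * d 2)"
    by (simp add: DERIV_imp_deriv powser_zero diffs_def c_def numeral_2_eq_2)
  show "G 0 = of_real (d 0)" "deriv G 0 = - of_real (d 1)"
    unfolding dG unfolding G_eq powser_zero by (simp_all add: diffs_def c_def)
qed

lemma d0: "complex_of_real (d 0) \<noteq> 0" using d_pos[of 0] by simp

sublocale small_entire G C "sqrt B"
  by unfold_locales (use norm_G_le G_holomorphic G_values d0 B in auto)

text \<open>On the negative axis all terms of \<open>G\<close> are positive, so
  \<open>G (- x)\<close> dominates \<open>d (Suc n) * x ^ Suc n\<close> for every \<open>n\<close>.
  This contradicts the polynomial growth that finitely many roots would force.\<close>

lemma infinite_roots: "infinite {a. G a = 0}"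
proof
  assume "finite {a. G a = 0}"
  then obtain K n where Kn: "\<And>w. norm w \<ge> 1 \<Longrightarrow> norm (G w) \<le> K * norm w ^ n"
    using finite_roots_imp_poly_growth by blast
  have le: "d (Suc n) * x \<le> K" if x: "x \<ge> 1" for x :: real
  proof -
    have eq: "c m * (- of_real x) ^ m = of_real (d m * x ^ m)" for m
    proof -
      have "(- complex_of_real x) ^ m = (-1) ^ m * of_real x ^ m" by (rule power_minus)
      moreover have "(-1) ^ m * (-1) ^ m = (1::complex)" unfolding power_mult_distrib[symmetric] by simp
      ultimately show ?thesis by (simp add: c_def mult_ac)
    qed
    have "summable (\<lambda>m. complex_of_real (d m * x ^ m))" using summable_G[of "- of_real x"] unfolding eq .
    hence sm: "summable (\<lambda>m. d m * x ^ m)" by (simp only: summable_complex_of_real)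
    have "G (- of_real x) = of_real (\<Sum>m. d m * x ^ m)"
      unfolding G_eq eq by (rule suminf_of_real[OF sm, symmetric])
    moreover have "d (Suc n) * x ^ Suc n \<le> (\<Sum>m. d m * x ^ m)"
      using sum_le_suminf[OF sm, of "{Suc n}"] d_pos x by (force intro: mult_nonneg_nonneg less_imp_le)
    ultimately have "d (Suc n) * x ^ Suc n \<le> norm (G (- of_real x))" by (simp add: norm_of_real)
    also have "\<dots> \<le> K * x ^ n" using Kn[of "- of_real x"] x by simp
    finally have "(d (Suc n) * x) * x ^ n \<le> K * x ^ n" by (simp add: mult_ac)
    thus ?thesis using x by (simp add: mult_le_cancel_right)
  qed
  \<comment> \<open>Chosen so that \<open>x \<ge> 1\<close> and
    \<open>d (Suc n) * x \<ge> K + 1\<close>, against \<open>le\<close>.\<close>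
  define x where "x = max 1 ((K + 1) / d (Suc n))"
  have "K + 1 \<le> d (Suc n) * x" using d_pos[of "Suc n"] by (simp add: x_def max_def field_simps)
  with le[of x] show False by (simp add: x_def)
qed

lemma mult_pos: "mult a > 0" if "G a = 0"
  using zorder_pos[OF that] by (simp add: mult_def)

text \<open>The operator \<open>s + 2 * w * d/dw\<close> multiplies \<open>w ^ m\<close> by
  \<open>2 * m + s\<close>. In the variable \<open>z\<close> with \<open>w = z^2\<close> it is
  \<open>s + z * d/dz\<close>, which appears when \<open>z powr s * G (z^2)\<close> is
  differentiated.\<close>

lemma euler_operator: "alt_series (\<lambda>m. (2 * real m + s) * d m) w = of_real s * G w + 2 * w * deriv G w"
proof -
  have "deriv G w = (\<Sum>m. diffs c m * w ^ m)" by (rule DERIV_imp_deriv[OF G_deriv])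
  hence "(\<lambda>m. of_nat m * c m * w ^ (m - Suc 0)) sums deriv G w"
    using diffs_equiv[OF summable_diffs, of w] by simp
  hence "(\<lambda>m. 2 * w * (of_nat m * c m * w ^ (m - Suc 0))) sums (2 * w * deriv G w)"
    by (rule sums_mult)
  hence "(\<lambda>m. of_real s * (c m * w ^ m) + 2 * w * (of_nat m * c m * w ^ (m - Suc 0)))
            sums (of_real s * G w + 2 * w * deriv G w)"
    unfolding G_eq[of w] by (rule sums_add[OF sums_mult[OF summable_sums[OF summable_G]]])
  moreover have "of_real s * (c m * w ^ m) + 2 * w * (of_nat m * c m * w ^ (m - Suc 0)) =
      of_real ((-1) ^ m * ((2 * real m + s) * d m)) * w ^ m" for m
    by (cases m) (simp_all add: c_def algebra_simps)
  ultimately show ?thesis unfolding alt_series_def by (simp add: sums_iff)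
qed

text \<open>The right half-plane is open and avoids the branch cut, so the formula for
  \<open>F\<close> there determines its derivative. The conclusion has the shape of the hypothesis,
  with exponent \<open>s - 1\<close>, so the lemma can be iterated.\<close>

lemma deriv_powr_times_G:
  assumes F: "\<And>z. Re z > 0 \<Longrightarrow> F z = K * (z / 2) powr of_real s * G (z\<^sup>2)" and z: "Re z > 0"
  shows "deriv F z = K / 2 * (z / 2) powr of_real (s - 1) * alt_series (\<lambda>m. (2 * real m + s) * d m) (z\<^sup>2)"
proof -
  have "z \<noteq> 0" using z by auto
  have "z / 2 \<notin> \<real>\<^sub>\<le>\<^sub>0" using z by (simp add: complex_nonpos_Reals_iff)
  hence "((\<lambda>z. (z / 2) powr of_real s) has_field_derivative
           of_real s * (z / 2) powr (of_real s - 1) * (1 / 2)) (at z)"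
    by (intro DERIV_chain2[OF has_field_derivative_powr]) (auto intro!: derivative_eq_intros)
  moreover have "((\<lambda>z. G (z\<^sup>2)) has_field_derivative deriv G (z\<^sup>2) * (2 * z)) (at z)"
    by (intro DERIV_chain2[OF holomorphic_derivI[OF hol open_UNIV UNIV_I]])
       (auto intro!: derivative_eq_intros)
  ultimately have "((\<lambda>z. K * (z / 2) powr of_real s * G (z\<^sup>2)) has_field_derivative
      K * (of_real s * (z / 2) powr (of_real s - 1) * (1 / 2)) * G (z\<^sup>2)
        + deriv G (z\<^sup>2) * (2 * z) * (K * (z / 2) powr of_real s)) (at z)"
    by (intro DERIV_mult DERIV_cmult)
  also have "(z / 2) powr complex_of_real s = (z / 2) powr (of_real s - 1) * (z / 2)"
    using \<open>z \<noteq> 0\<close> by (simp add: powr_diff)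
  also have "K * (of_real s * (z / 2) powr (of_real s - 1) * (1 / 2)) * G (z\<^sup>2)
        + deriv G (z\<^sup>2) * (2 * z) * (K * ((z / 2) powr (of_real s - 1) * (z / 2))) =
      K / 2 * (z / 2) powr of_real (s - 1) * (of_real s * G (z\<^sup>2) + 2 * z\<^sup>2 * deriv G (z\<^sup>2))"
    by (simp add: algebra_simps power2_eq_square)
  also have "of_real s * G (z\<^sup>2) + 2 * z\<^sup>2 * deriv G (z\<^sup>2) = alt_series (\<lambda>m. (2 * real m + s) * d m) (z\<^sup>2)"
    by (rule euler_operator[symmetric])
  finally have D: "((\<lambda>z. K * (z / 2) powr of_real s * G (z\<^sup>2)) has_field_derivative
     K / 2 * (z / 2) powr of_real (s - 1) * alt_series (\<lambda>m. (2 * real m + s) * d m) (z\<^sup>2)) (at z)" .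
  have "eventually (\<lambda>z. F z = K * (z / 2) powr of_real s * G (z\<^sup>2)) (nhds z)"
    using eventually_nhds_in_open[OF open_halfspace_Re_gt, of z 0] z
    by (auto elim!: eventually_mono simp: F)
  from deriv_cong_ev[OF this refl] show ?thesis using DERIV_imp_deriv[OF D] by simp
qed

end

section \<open>Reciprocal power sums of positive roots, and stability of positivity under the Euler
  operator\<close>

locale pos_root_series = pos_coeff_series +
  assumes roots: "\<And>w. alt_series d w = 0 \<Longrightarrow> w \<in> \<real> \<and> Re w > 0"
begin

lemma root_real: "a = of_real (Re a)" "Re a > 0" if "G a = 0"
  using roots[OF that] by (auto simp: complex_is_Real_iff complex_eq_iff)

lemma real_sum_inverse_tendsto: "((\<lambda>R. \<Sum>a\<in>Z R. real (mult a) / Re a) \<longlongrightarrow> d 1 / d 0) at_top"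
proof -
  have "(\<Sum>a\<in>Z R. of_nat (mult a) / a) = of_real (\<Sum>a\<in>Z R. real (mult a) / Re a)" for R
    unfolding of_real_sum
  proof (intro sum.cong refl)
    fix a assume "a \<in> Z R"
    hence "a = of_real (Re a)" using root_real(1) by (simp add: Z_def)
    thus "of_nat (mult a) / a = of_real (real (mult a) / Re a)"
      by (metis of_real_divide of_real_of_nat_eq)
  qed
  with sum_inverse_tendsto have "((\<lambda>R. complex_of_real (\<Sum>a\<in>Z R. real (mult a) / Re a)) \<longlongrightarrow> of_real (d 1 / d 0)) at_top"
    by (simp add: G_values)
  thus ?thesis by (simp only: tendsto_of_real_iff)
qed

text \<open>The value is Newton's identity \<open>e1^2 - 2 * e2\<close> for the reciprocal roots,
  whose elementary symmetric functions are \<open>d k / d 0\<close>.\<close>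

lemma real_sum_inverse_square_tendsto:
  "((\<lambda>R. \<Sum>a\<in>Z R. real (mult a) / (Re a)\<^sup>2) \<longlongrightarrow> (d 1 / d 0)\<^sup>2 - 2 * d 2 / d 0) at_top"
proof -
  have "(\<Sum>a\<in>Z R. of_nat (mult a) / a\<^sup>2) = of_real (\<Sum>a\<in>Z R. real (mult a) / (Re a)\<^sup>2)" for R
    unfolding of_real_sum
  proof (intro sum.cong refl)
    fix a assume "a \<in> Z R"
    hence "a = of_real (Re a)" using root_real(1) by (simp add: Z_def)
    thus "of_nat (mult a) / a\<^sup>2 = of_real (real (mult a) / (Re a)\<^sup>2)"
      by (metis of_real_divide of_real_of_nat_eq of_real_power)
  qed
  with sum_inverse_square_tendsto have "((\<lambda>R. complex_of_real (\<Sum>a\<in>Z R. real (mult a) / (Re a)\<^sup>2))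
      \<longlongrightarrow> of_real ((d 1 / d 0)\<^sup>2 - 2 * d 2 / d 0)) at_top"
    by (simp add: G_values)
  thus ?thesis by (simp only: tendsto_of_real_iff)
qed

text \<open>The roots of \<open>s G + 2 w G'\<close> are those \<open>w\<close> for which \<open>w G'(w)/G(w) = \<Sum> w / (w - a)\<close> equals
  \<open>-s/2\<close>; each \<open>w / (w - a)\<close> has imaginary part of a fixed sign off the real line and is
  positive for \<open>w < 0\<close>.\<close>

lemma euler_operator_roots:
  assumes s: "s > 0" and w: "alt_series (\<lambda>m. (2 * real m + s) * d m) w = 0"
  shows "w \<in> \<real> \<and> Re w > 0"
proof (rule ccontr)
  assume not: "\<not> (w \<in> \<real> \<and> Re w > 0)"
  hence Gw: "G w \<noteq> 0" using roots by blast
  have eq: "of_real s * G w + 2 * w * deriv G w = 0" using w euler_operator by simp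
  have "w * (deriv G w / G w) = of_real (- s / 2)"
    using eq Gw by (simp add: field_simps eq_neg_iff_add_eq_0)
  moreover have "((\<lambda>R. w * (\<Sum>a\<in>Z R. of_nat (mult a) / (w - a))) \<longlongrightarrow> w * (deriv G w / G w)) at_top"
    by (intro tendsto_mult tendsto_const logderiv_tendsto Gw)
  ultimately have lim: "((\<lambda>R. w * (\<Sum>a\<in>Z R. of_nat (mult a) / (w - a))) \<longlongrightarrow> of_real (- s / 2)) at_top"
    by simp
  \<comment> \<open>Multiplying numerator and denominator by the conjugate of \<open>w - a\<close>
    exposes the real and imaginary parts, since \<open>a\<close> is real.\<close>
  have summand: "w * (of_nat (mult a) / (w - a)) =
      of_real (mult a / (norm (w - a))\<^sup>2) * (of_real ((norm w)\<^sup>2) - w * of_real (Re a))" if "a \<in> Z R" for a R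
  proof -
    have a: "a = of_real (Re a)" using that root_real by (simp add: Z_def)
    have "w / (w - a) = w * cnj (w - a) / (of_real (norm (w - a)))\<^sup>2"
      by (subst complex_div_cnj) simp
    also have "w * cnj (w - a) = of_real ((norm w)\<^sup>2) - w * of_real (Re a)"
      by (subst a) (simp add: complex_eq_iff cmod_power2, simp add: algebra_simps power2_eq_square)
    finally have "w / (w - a) = (of_real ((norm w)\<^sup>2) - w * of_real (Re a)) / (of_real (norm (w - a)))\<^sup>2" .
    moreover have "w * (of_nat (mult a) / (w - a)) = of_nat (mult a) * (w / (w - a))" by simp
    ultimately show ?thesis by simp
  qed
  have sum: "w * (\<Sum>a\<in>Z R. of_nat (mult a) / (w - a)) =
      (\<Sum>a\<in>Z R. of_real (mult a / (norm (w - a))\<^sup>2) * (of_real ((norm w)\<^sup>2) - w * of_real (Re a)))" for R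
    unfolding sum_distrib_left by (intro sum.cong refl summand)
  show False
  proof (cases "Im w = 0")
    case True
    \<comment> \<open>Here all truncated sums have nonnegative real part, but their limit is
      \<open>- s / 2 < 0\<close>.\<close>
    hence "Re w \<le> 0" using not by (auto simp: complex_is_Real_iff)
    hence "0 \<le> Re (w * (\<Sum>a\<in>Z R. of_nat (mult a) / (w - a)))" for R
      unfolding sum Re_sum
    proof (intro sum_nonneg)
      fix a assume "a \<in> Z R"
      hence "Re w * Re a \<le> 0"
        using \<open>Re w \<le> 0\<close> root_real(2)[of a] by (auto simp: Z_def intro: mult_nonpos_nonneg)
      thus "0 \<le> Re (of_real (mult a / (norm (w - a))\<^sup>2) * (of_real ((norm w)\<^sup>2) - w * of_real (Re a)))"
        using order_trans[of "Re w * Re a" 0 "(norm w)\<^sup>2"] by (simp flip: of_real_power)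
    qed
    moreover have "((\<lambda>R. Re (w * (\<Sum>a\<in>Z R. of_nat (mult a) / (w - a)))) \<longlongrightarrow> - s / 2) at_top"
      using tendsto_Re[OF lim] by simp
    ultimately have "0 \<le> - s / 2"
      by (intro tendsto_lowerbound[OF _ _ trivial_limit_at_top_linorder]) auto
    thus False using s by simp
  next
    case False
    \<comment> \<open>Off the real line the sums of the nonnegative terms \<open>e a\<close> tend to
      0. A single root \<open>b\<close>, present once \<open>R \<ge> norm b\<close>, keeps them
      above \<open>e b > 0\<close>; so one root has to exist.\<close>
    have "{a. G a = 0} \<noteq> {}" using infinite_roots by (rule infinite_imp_nonempty)
    then obtain b where b: "G b = 0" by blast
    define e where "e = (\<lambda>a. real (mult a) / (norm (w - a))\<^sup>2 * Re a)"
    have "Im (w * (\<Sum>a\<in>Z R. of_nat (mult a) / (w - a))) = - Im w * (\<Sum>a\<in>Z R. e a)" for R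
      unfolding sum unfolding Im_sum sum_distrib_left by (intro sum.cong refl) (simp add: e_def)
    hence "((\<lambda>R. - Im w * (\<Sum>a\<in>Z R. e a)) \<longlongrightarrow> 0) at_top"
      using tendsto_Im[OF lim] by simp
    from tendsto_mult_left[OF this, of "- 1 / Im w"]
    have lim0: "((\<lambda>R. \<Sum>a\<in>Z R. e a) \<longlongrightarrow> 0) at_top" using False by simp
    have e_nonneg: "0 \<le> e a" if "a \<in> Z R" for a R
      using root_real(2)[of a] that unfolding e_def Z_def
      by (intro mult_nonneg_nonneg divide_nonneg_nonneg) auto
    have "eventually (\<lambda>R. e b \<le> (\<Sum>a\<in>Z R. e a)) at_top"
      using eventually_ge_at_top[of "norm b"]
    proof eventually_elim
      case (elim R)
      have "b \<in> Z R" using b elim by (simp add: Z_def)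
      thus ?case
        by (rule member_le_sum[OF _ _ finite_Z]) (use e_nonneg in blast)
    qed
    hence "e b \<le> 0" using lim0 by (intro tendsto_lowerbound) auto
    moreover have "e b > 0"
      unfolding e_def using b Gw mult_pos[OF b] root_real(2)[OF b]
      by (intro mult_pos_pos divide_pos_pos zero_less_power) auto
    ultimately show False by simp
  qed
qed

text \<open>The linear factor is absorbed into the geometric one by
  \<open>2 * m + s \<le> (2 + s) * 2 ^ m\<close>, which doubles \<open>B\<close>. Positivity of the
  roots is \<open>euler_operator_roots\<close>.\<close>

lemma euler_operator_pos_root_series:
  assumes s: "s > 0"
  shows "pos_root_series (\<lambda>m. (2 * real m + s) * d m) (C * (2 + s)) (2 * B)"
proof
  fix m
  show "0 < (2 * real m + s) * d m" using s d_pos[of m] by simp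
  have "real m \<le> real (2 ^ m)" by (intro of_nat_mono less_imp_le less_exp)
  hence two: "real m \<le> 2 ^ m" by simp
  have "s * 1 \<le> s * 2 ^ m" using s by (intro mult_left_mono) auto
  moreover have "(2 + s) * 2 ^ m = 2 * 2 ^ m + s * 2 ^ m" by (rule distrib_right)
  ultimately have "2 * real m + s \<le> (2 + s) * 2 ^ m" using two by linarith
  hence "(2 * real m + s) * d m \<le> ((2 + s) * 2 ^ m) * (C * B ^ m / fact (2 * m))"
    using s d_pos[of m] by (intro mult_mono d_le) (auto intro: less_imp_le)
  thus "(2 * real m + s) * d m \<le> C * (2 + s) * (2 * B) ^ m / fact (2 * m)"
    by (simp add: field_simps)
next
  show "0 < 2 * B" using B by simp
next
  fix w assume "alt_series (\<lambda>m. (2 * real m + s) * d m) w = 0"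
  thus "w \<in> \<real> \<and> 0 < Re w" by (rule euler_operator_roots[OF s])
qed

end

section \<open>Listing weighted points on the line\<close>

lemma finite_down_closed_eq_lessThan:
  fixes A :: "nat set"
  assumes "finite A" "\<And>i j. j \<in> A \<Longrightarrow> i \<le> j \<Longrightarrow> i \<in> A"
  shows "A = {..<card A}"
proof -
  define k where "k = (LEAST k. k \<notin> A)"
  have k: "k \<notin> A" unfolding k_def
    by (rule LeastI_ex) (use assms(1) ex_new_if_finite infinite_UNIV_nat in blast)
  have "A = {..<k}"
  proof (intro set_eqI iffI)
    fix i assume "i \<in> A"
    thus "i \<in> {..<k}" using k assms(2)[of i k] by (cases "i < k") auto
  next
    fix i assume "i \<in> {..<k}"
    thus "i \<in> A" unfolding k_def using not_less_Least by blast
  qed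
  thus ?thesis by (metis card_lessThan)
qed

text \<open>To be used with the positive zeros as \<open>X\<close> and their multiplicities as
  \<open>m\<close>; \<open>listing\<close> is then \<open>lists_pos_zeros\<close>, and
  \<open>N\<close> is the counting function of the zeros.\<close>

locale weighted_points =
  fixes X :: "real set" and m :: "real \<Rightarrow> nat"
  assumes m_pos: "\<And>x. x \<in> X \<Longrightarrow> m x > 0"
    and finite_le: "\<And>r. finite (X \<inter> {..r})" and infinite_X: "infinite X"
begin

definition listing :: "(nat \<Rightarrow> real) \<Rightarrow> bool" where
  "listing h \<longleftrightarrow> mono h \<and> range h = X \<and> (\<forall>x\<in>X. card {n. h n = x} = m x)"

definition N :: "real \<Rightarrow> nat" where "N r = (\<Sum>x\<in>X \<inter> {..r}. m x)"

lemma N_unbounded: "\<exists>x\<in>X. n < N x"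
proof -
  obtain Y where Y: "Y \<subseteq> X" "finite Y" "card Y = Suc n"
    using infinite_arbitrarily_large[OF infinite_X] by blast
  have "Y \<noteq> {}" using Y(3) by auto
  hence M: "Max Y \<in> Y" using Y(2) by simp
  have "Suc n = (\<Sum>x\<in>Y. 1)" using Y(3) by simp
  also have "\<dots> \<le> (\<Sum>x\<in>Y. m x)" using Y(1) m_pos by (intro sum_mono) (auto simp: Suc_le_eq)
  also have "\<dots> \<le> N (Max Y)"
    unfolding N_def using Y by (intro sum_mono2 finite_le) auto
  finally show ?thesis using M Y(1) by (intro bexI[of _ "Max Y"]) auto
qed

lemma listing_fibre:
  assumes "listing h" "x \<in> X"
  shows "finite {n. h n = x}" "card {n. h n = x} = m x"
  using assms m_pos[of x] card_ge_0_finite[of "{n. h n = x}"] by (auto simp: listing_def)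

text \<open>The fibres over the points up to \<open>r\<close> have \<open>N r\<close> elements
  altogether, and their union is an initial segment because \<open>h\<close> is monotone. The
  equivalence determines \<open>h\<close>, and it turns sums over points up to \<open>r\<close> into
  partial sums of length \<open>N r\<close>.\<close>

lemma listing_le_iff:
  assumes h: "listing h"
  shows "h n \<le> r \<longleftrightarrow> n < N r"
proof -
  have eq: "{n. h n \<le> r} = (\<Union>x\<in>X \<inter> {..r}. {n. h n = x})"
    using h by (auto simp: listing_def)
  have fin: "finite {n. h n \<le> r}"
    unfolding eq using finite_le listing_fibre[OF h] by auto
  have "card {n. h n \<le> r} = N r"
    unfolding eq N_def using listing_fibre[OF h]
    by (subst card_UN_disjoint) (auto intro!: finite_le)
  moreover have "{n. h n \<le> r} = {..<card {n. h n \<le> r}}"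
    using h by (intro finite_down_closed_eq_lessThan fin) (auto simp: listing_def dest: monoD)
  ultimately show ?thesis by auto
qed

lemma listing_unique:
  assumes "listing h" "listing h'"
  shows "h = h'"
proof
  fix n
  have "h n \<le> r \<longleftrightarrow> h' n \<le> r" for r
    using listing_le_iff[OF assms(1)] listing_le_iff[OF assms(2)] by simp
  thus "h n = h' n" by (metis order_antisym order_refl)
qed

lemma listing_exists: "\<exists>h. listing h"
proof -
  \<comment> \<open>By \<open>listing_le_iff\<close> the term \<open>h n\<close> of a listing has to
    be the least element of \<open>A n\<close>. That minimum exists because only finitely many
    points of \<open>A n\<close> lie below a given one.\<close>
  define A where "A = (\<lambda>n. {x\<in>X. n < N x})"
  have "\<exists>x\<in>A n. \<forall>y\<in>A n. x \<le> y" for n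
  proof -
    obtain x0 where x0: "x0 \<in> A n" using N_unbounded[of n] by (auto simp: A_def)
    have fin: "finite (A n \<inter> {..x0})"
      by (rule finite_subset[OF _ finite_le[of x0]]) (auto simp: A_def)
    have ne: "A n \<inter> {..x0} \<noteq> {}" using x0 by auto
    have "Min (A n \<inter> {..x0}) \<le> y" if "y \<in> A n" for y
    proof (cases "y \<le> x0")
      case False
      have "Min (A n \<inter> {..x0}) \<le> x0" using Min_in[OF fin ne] by auto
      with False show ?thesis by linarith
    qed (use that fin in auto)
    thus ?thesis using Min_in[OF fin ne] by blast
  qed
  then obtain h where h: "\<And>n. h n \<in> A n" "\<And>n y. y \<in> A n \<Longrightarrow> h n \<le> y" by metis
  \<comment> \<open>\<open>N x - m x\<close> counts the points strictly below \<open>x\<close> with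
    weights. The second conjunct ensures that the truncated subtraction yields an interval of
    exactly \<open>m x\<close> indices.\<close>
  have fib: "{n. h n = x} = {N x - m x..<N x} \<and> m x \<le> N x" if x: "x \<in> X" for x
  proof -
    define B where "B = X \<inter> {..<x}"
    have finB: "finite B" by (rule finite_subset[OF _ finite_le[of x]]) (auto simp: B_def)
    have "X \<inter> {..x} = insert x B" using x by (auto simp: B_def)
    hence Nx: "N x = m x + sum m B" unfolding N_def using finB by (simp add: B_def)
    have "h n = x \<longleftrightarrow> sum m B \<le> n \<and> n < N x" for n
    proof
      assume hn: "h n = x"
      have "sum m B \<le> n"
      proof (cases "B = {}")
        case False
        \<comment> \<open>The predecessor of \<open>x\<close> in \<open>X\<close>: if
          \<open>n\<close> were below \<open>N y = sum m B\<close>, minimality would give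
          \<open>h n \<le> y < x\<close>.\<close>
        define y where "y = Max B"
        have y: "y \<in> B" using False finB by (simp add: y_def)
        have "X \<inter> {..y} = B"
        proof (intro equalityI subsetI)
          fix z assume "z \<in> B"
          thus "z \<in> X \<inter> {..y}" using Max_ge[OF finB, of z] by (simp add: B_def y_def)
        qed (use y in \<open>auto simp: B_def\<close>)
        hence "N y = sum m B" by (simp add: N_def)
        moreover have "\<not> n < N y"
        proof
          assume "n < N y"
          hence "h n \<le> y" using y by (intro h(2)) (simp add: A_def B_def)
          thus False using hn y by (simp add: B_def)
        qed
        ultimately show ?thesis by simp
      qed simp
      thus "sum m B \<le> n \<and> n < N x" using h(1)[of n] hn by (simp add: A_def)
    next
      assume n: "sum m B \<le> n \<and> n < N x"
      have "h n \<le> x" using h(2)[of x n] n x by (simp add: A_def)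
      moreover have "\<not> h n < x"
      proof
        assume "h n < x"
        hence "N (h n) \<le> sum m B"
          unfolding N_def by (intro sum_mono2 finB) (auto simp: B_def)
        thus False using n h(1)[of n] by (simp add: A_def)
      qed
      ultimately show "h n = x" by simp
    qed
    hence "{n. h n = x} = {n. sum m B \<le> n \<and> n < N x}" by (simp only:)
    also have "\<dots> = {N x - m x..<N x}" using Nx by auto
    finally show ?thesis using Nx by simp
  qed
  have "listing h" unfolding listing_def
  proof (intro conjI ballI)
    show "mono h"
    proof (rule monoI)
      fix i j :: nat assume "i \<le> j"
      hence "h j \<in> A i" using h(1)[of j] by (auto simp: A_def)
      thus "h i \<le> h j" by (rule h(2))
    qed
    show "range h = X"
    proof (intro equalityI subsetI)
      fix x assume x: "x \<in> X"
      have "N x - m x \<in> {N x - m x..<N x}" using fib[OF x] m_pos[OF x] by auto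
      hence "N x - m x \<in> {n. h n = x}" using fib[OF x] by (simp only:)
      hence "h (N x - m x) = x" by (rule CollectD)
      from this[symmetric] show "x \<in> range h" by (rule range_eqI)
    qed (use h(1) in \<open>auto simp: A_def\<close>)
    fix x assume "x \<in> X"
    from fib[OF this] show "card {n. h n = x} = m x" by simp
  qed
  thus ?thesis by blast
qed

lemma ex1_listing: "\<exists>!h. listing h"
  using listing_exists listing_unique by blast

text \<open>The partial sum of length \<open>N r\<close> is the weighted sum over the points up to
  \<open>r\<close>. Nonnegativity bounds all partial sums through these and gives convergence; the
  limit is then identified along the lengths \<open>N r\<close>, which tend to infinity.\<close>

lemma listing_sums:
  assumes h: "listing h" and nonneg: "\<And>x. x \<in> X \<Longrightarrow> 0 \<le> (f x :: real)"
    and lim: "((\<lambda>r. \<Sum>x\<in>X \<inter> {..r}. real (m x) * f x) \<longlongrightarrow> S) at_top"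
  shows "(\<lambda>n. f (h n)) sums S"
proof -
  have hX: "h n \<in> X" for n using h by (auto simp: listing_def)
  have eq: "(\<Sum>n<N r. f (h n)) = (\<Sum>x\<in>X \<inter> {..r}. real (m x) * f x)" for r
  proof -
    have "{..<N r} = {n. h n \<le> r}" using listing_le_iff[OF h] by auto
    also have "\<dots> = (\<Union>x\<in>X \<inter> {..r}. {n. h n = x})" using hX by auto
    finally have "(\<Sum>n<N r. f (h n)) = (\<Sum>n\<in>(\<Union>x\<in>X \<inter> {..r}. {n. h n = x}). f (h n))" by simp
    also have "\<dots> = (\<Sum>x\<in>X \<inter> {..r}. \<Sum>n\<in>{n. h n = x}. f (h n))"
      using listing_fibre[OF h] by (intro sum.UNION_disjoint finite_le) auto
    also have "\<dots> = (\<Sum>x\<in>X \<inter> {..r}. real (m x) * f x)"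
      using listing_fibre[OF h] by (intro sum.cong) auto
    finally show ?thesis .
  qed
  have N: "eventually (\<lambda>r. n \<le> N r) at_top" for n
    using eventually_ge_at_top[of "h n"] by eventually_elim (use listing_le_iff[OF h, of n] in auto)
  have "summable (\<lambda>n. f (h n))"
  proof (rule summableI_nonneg_bounded)
    fix n
    have "eventually (\<lambda>r. (\<Sum>n<N r. f (h n)) < S + 1) at_top"
      unfolding eq using order_tendstoD(2)[OF lim, of "S + 1"] by simp
    from eventually_happens[OF eventually_conj[OF this N[of n]]]
    obtain r where "(\<Sum>n<N r. f (h n)) < S + 1" "n \<le> N r" by auto
    moreover from this(2) have "(\<Sum>k<n. f (h k)) \<le> (\<Sum>n<N r. f (h n))"
      using nonneg hX by (intro sum_mono2) auto
    ultimately show "(\<Sum>k<n. f (h k)) \<le> S + 1" by linarith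
  qed (use nonneg hX in auto)
  hence sums: "(\<lambda>n. f (h n)) sums suminf (\<lambda>n. f (h n))" by (rule summable_sums)
  have "filterlim N at_top at_top" using N by (simp add: filterlim_at_top)
  from filterlim_compose[OF sums[unfolded sums_def] this]
  have "((\<lambda>r. \<Sum>n<N r. f (h n)) \<longlongrightarrow> suminf (\<lambda>n. f (h n))) at_top" .
  hence "suminf (\<lambda>n. f (h n)) = S"
    using lim unfolding eq by (intro tendsto_unique) auto
  with sums show ?thesis by simp
qed

end

section \<open>From roots in the variable \<open>w = z^2\<close> to listed positive zeros in
  \<open>z\<close>\<close>

context pos_root_series
begin

text \<open>Squaring maps the positive zeros of \<open>F\<close> bijectively onto the roots of
  \<open>G\<close> and preserves multiplicities. Hence the sums of \<open>1 / x^2\<close> and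
  \<open>1 / x^4\<close> over the zeros are those of \<open>1 / a\<close> and \<open>1 / a^2\<close>
  over the roots.\<close>

lemma pos_zero_sums:
  assumes K: "K \<noteq> 0" and F: "\<And>z. Re z > 0 \<Longrightarrow> F z = K * (z / 2) powr p * G (z\<^sup>2)"
  shows "(\<lambda>n. 1 / pos_zero F n ^ 2) sums (d 1 / d 0)"
    and "(\<lambda>n. 1 / pos_zero F n ^ 4) sums ((d 1 / d 0)\<^sup>2 - 2 * d 2 / d 0)"
proof -
  define X where "X = {x. 0 < x \<and> F (of_real x) = 0}"
  define m where "m = (\<lambda>x::real. mult (of_real (x\<^sup>2)))"
  have X: "x \<in> X \<longleftrightarrow> 0 < x \<and> G (of_real (x\<^sup>2)) = 0" for x
    using F[of "of_real x"] K by (auto simp: X_def)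
  have ord: "zorder F (of_real x) = int (m x)" if x: "x \<in> X" for x
  proof -
    let ?a = "complex_of_real (x\<^sup>2)"
    have x0: "x > 0" using x X by simp
    obtain q where q: "q holomorphic_on UNIV" "q ?a \<noteq> 0" "\<And>w. G w = (w - ?a) ^ mult ?a * q w"
      using entire_factor_root[OF hol f0, of ?a] unfolding mult_def by blast
    \<comment> \<open>The factor \<open>z^2 - x^2\<close> splits as
      \<open>(z - x) * (z + x)\<close>; near the positive point \<open>x\<close> the factor
      \<open>z + x\<close> and the power of \<open>z / 2\<close> do not vanish, so the cofactor is
      nonzero at \<open>x\<close>.\<close>
    show ?thesis
    proof (rule zorder_eqI[of "{z. Re z > 0}" _ "\<lambda>z. K * (z / 2) powr p * (z + of_real x) ^ m x * q (z\<^sup>2)"])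
      show "open {z. Re z > 0}" by (rule open_halfspace_Re_gt)
      have "(\<lambda>z. q (z\<^sup>2)) holomorphic_on {z. Re z > 0}"
        by (rule holomorphic_on_compose_gen[OF _ q(1), unfolded o_def]) (auto intro!: holomorphic_intros)
      thus "(\<lambda>z. K * (z / 2) powr p * (z + of_real x) ^ m x * q (z\<^sup>2)) holomorphic_on {z. Re z > 0}"
        by (intro holomorphic_intros) (auto simp: complex_nonpos_Reals_iff)
      show "K * (complex_of_real x / 2) powr p * (complex_of_real x + complex_of_real x) ^ m x * q ((complex_of_real x)\<^sup>2) \<noteq> 0"
        using q(2) K x0 by (simp add: powr_def flip: of_real_add)
    next
      fix z :: complex assume z: "z \<in> {z. Re z > 0}"
      have "z\<^sup>2 - ?a = (z - of_real x) * (z + of_real x)" by (simp add: power2_eq_square algebra_simps)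
      hence "G (z\<^sup>2) = ((z - of_real x) * (z + of_real x)) ^ m x * q (z\<^sup>2)"
        using q(3)[of "z\<^sup>2"] by (simp only: m_def)
      thus "F z = K * (z / 2) powr p * (z + of_real x) ^ m x * q (z\<^sup>2) * (z - of_real x) powi int (m x)"
        using F[of z] z by (simp add: power_mult_distrib power_int_def mult_ac)
    qed (use x0 in auto)
  qed
  have bij: "bij_betw (\<lambda>x. complex_of_real (x\<^sup>2)) (X \<inter> {..r}) (Z (r\<^sup>2))" if r: "r \<ge> 0" for r
  proof (rule bij_betw_imageI)
    show "inj_on (\<lambda>x. complex_of_real (x\<^sup>2)) (X \<inter> {..r})"
      by (rule inj_onI) (auto simp: X simp del: of_real_power)
    show "(\<lambda>x. complex_of_real (x\<^sup>2)) ` (X \<inter> {..r}) = Z (r\<^sup>2)"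
    proof (intro equalityI subsetI)
      fix a assume "a \<in> (\<lambda>x. complex_of_real (x\<^sup>2)) ` (X \<inter> {..r})"
      then obtain x where x: "a = complex_of_real (x\<^sup>2)" "x \<in> X" "x \<le> r" by auto
      have "norm a = x\<^sup>2" unfolding x(1) norm_of_real by simp
      thus "a \<in> Z (r\<^sup>2)" using x by (simp add: Z_def X power_mono less_imp_le del: of_real_power)
    next
      fix a assume a: "a \<in> Z (r\<^sup>2)"
      hence Ga: "G a = 0" and "norm a \<le> r\<^sup>2" by (auto simp: Z_def)
      hence "Re a \<le> r\<^sup>2" using complex_Re_le_cmod[of a] by linarith
      hence "sqrt (Re a) \<le> r" using r by (intro real_le_lsqrt)
      moreover have "a = complex_of_real ((sqrt (Re a))\<^sup>2)"
        using root_real[OF Ga] by simp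
      moreover from this have "sqrt (Re a) \<in> X" unfolding X using root_real(2)[OF Ga] Ga by simp
      ultimately show "a \<in> (\<lambda>x. complex_of_real (x\<^sup>2)) ` (X \<inter> {..r})" by blast
    qed
  qed
  interpret W: weighted_points X m
  proof
    show "m x > 0" if "x \<in> X" for x using that mult_pos by (simp add: X m_def)
    show "finite (X \<inter> {..r})" for r
    proof (rule finite_subset)
      \<comment> \<open>\<open>bij\<close> is available only for nonnegative radii.\<close>
      show "X \<inter> {..r} \<subseteq> X \<inter> {..max r 0}" by auto
      show "finite (X \<inter> {..max r 0})" using bij_betw_finite[OF bij, of "max r 0"] finite_Z by simp
    qed
    have "{a. G a = 0} \<subseteq> (\<lambda>x. complex_of_real (x\<^sup>2)) ` X"
    proof
      fix a assume "a \<in> {a. G a = 0}"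
      hence Ga: "G a = 0" by simp
      have "a = complex_of_real ((sqrt (Re a))\<^sup>2)"
        using root_real[OF Ga] by simp
      moreover from this have "sqrt (Re a) \<in> X" unfolding X using root_real(2)[OF Ga] Ga by simp
      ultimately show "a \<in> (\<lambda>x. complex_of_real (x\<^sup>2)) ` X" by blast
    qed
    thus "infinite X" using infinite_roots finite_subset finite_imageI by metis
  qed
  have "lists_pos_zeros F h \<longleftrightarrow> W.listing h" for h
    unfolding lists_pos_zeros_def W.listing_def X_def[symmetric] using ord by auto
  hence "lists_pos_zeros F = W.listing" by blast
  \<comment> \<open>Unique existence of a listing makes the definite description in
    \<open>pos_zero\<close> meaningful.\<close>
  hence "W.listing (pos_zero F)"
    unfolding pos_zero_def using theI'[OF W.ex1_listing] by simp
  note sums = W.listing_sums[OF this]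
  have eq: "(\<Sum>x\<in>X \<inter> {..r}. real (m x) * g (x\<^sup>2)) = (\<Sum>a\<in>Z (r\<^sup>2). real (mult a) * g (Re a))"
    if "r \<ge> 0" for r and g :: "real \<Rightarrow> real"
    using sum.reindex_bij_betw[OF bij[OF that], of "\<lambda>a. real (mult a) * g (Re a)"]
    by (simp add: m_def del: of_real_power)
  \<comment> \<open>Substitution \<open>R = r^2\<close> in the limit over the roots.\<close>
  have transfer: "((\<lambda>r. \<Sum>x\<in>X \<inter> {..r}. real (m x) * g (x\<^sup>2)) \<longlongrightarrow> L) at_top"
    if "((\<lambda>R. \<Sum>a\<in>Z R. real (mult a) * g (Re a)) \<longlongrightarrow> L) at_top" for L and g :: "real \<Rightarrow> real"
  proof -
    have "filterlim (\<lambda>r::real. r\<^sup>2) at_top at_top" by real_asymp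
    from filterlim_compose[OF that this] show ?thesis
      by (rule Lim_transform_eventually)
         (use eventually_ge_at_top[of 0] in eventually_elim, simp add: eq)
  qed
  show "(\<lambda>n. 1 / pos_zero F n ^ 2) sums (d 1 / d 0)"
    using sums[OF _ transfer[of "\<lambda>t. 1 / t"]] real_sum_inverse_tendsto by simp
  have "((\<lambda>r. \<Sum>x\<in>X \<inter> {..r}. real (m x) * (1 / (x\<^sup>2)\<^sup>2)) \<longlongrightarrow> (d 1 / d 0)\<^sup>2 - 2 * d 2 / d 0) at_top"
    using transfer[of "\<lambda>t. 1 / t\<^sup>2"] real_sum_inverse_square_tendsto by simp
  thus "(\<lambda>n. 1 / pos_zero F n ^ 4) sums ((d 1 / d 0)\<^sup>2 - 2 * d 2 / d 0)"
    using sums[of "\<lambda>x. 1 / x ^ 4"] by simp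
qed

end

section \<open>Sine sums and sine transforms with increasing weights\<close>

text \<open>Multiplication by \<open>x - 1\<close> replaces the coefficients below the top by minus
  \<open>a 0\<close> and minus the increments \<open>b k\<close>. These are nonnegative up to sign
  and total \<open>a n\<close>, so for \<open>norm x > 1\<close> they contribute at most
  \<open>a n * norm x ^ n\<close>, less than the top term.\<close>

lemma Enestrom_Kakeya:
  fixes a :: "nat \<Rightarrow> real" and x :: complex
  assumes a0: "a 0 > 0" and mono: "\<And>k. k < n \<Longrightarrow> a k \<le> a (Suc k)" and x: "norm x > 1"
  shows "(\<Sum>k\<le>n. of_real (a k) * x ^ k) \<noteq> 0"
proof
  assume 0: "(\<Sum>k\<le>n. of_real (a k) * x ^ k) = 0"
  define b where "b = (\<lambda>k. a (Suc k) - a k)"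
  have b: "b k \<ge> 0" if "k < n" for k using mono[OF that] by (simp add: b_def)
  have id: "(x - 1) * (\<Sum>k\<le>n. of_real (a k) * x ^ k) =
      of_real (a n) * x ^ Suc n - (of_real (a 0) + (\<Sum>k<n. of_real (b k) * x ^ Suc k))" for n
    by (induction n) (auto simp: algebra_simps b_def)
  have pos: "a k > 0" if "k \<le> n" for k
    using that by (induction k) (use a0 mono in \<open>auto intro: less_le_trans simp: Suc_le_eq\<close>)
  have "a n * norm x ^ Suc n = norm (of_real (a n) * x ^ Suc n)"
    using pos[of n] by (simp add: norm_mult norm_power)
  also have "of_real (a n) * x ^ Suc n = of_real (a 0) + (\<Sum>k<n. of_real (b k) * x ^ Suc k)"
    using id[of n] 0 by simp
  also have "norm \<dots> \<le> norm (complex_of_real (a 0)) + (\<Sum>k<n. norm (of_real (b k) * x ^ Suc k))"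
    by (rule order_trans[OF norm_triangle_ineq add_left_mono[OF norm_sum]])
  also have "\<dots> \<le> a 0 * norm x ^ n + (\<Sum>k<n. b k * norm x ^ n)"
  proof (rule add_mono)
    show "norm (complex_of_real (a 0)) \<le> a 0 * norm x ^ n"
      using a0 one_le_power[of "norm x" n] x by simp
    show "(\<Sum>k<n. norm (of_real (b k) * x ^ Suc k)) \<le> (\<Sum>k<n. b k * norm x ^ n)"
    proof (rule sum_mono)
      fix k assume k: "k \<in> {..<n}"
      have "norm (of_real (b k) * x ^ Suc k) = b k * norm x ^ Suc k"
        using b[of k] k by (simp add: norm_mult norm_power)
      also have "\<dots> \<le> b k * norm x ^ n"
        using b[of k] k x by (intro mult_left_mono power_increasing) auto
      finally show "norm (of_real (b k) * x ^ Suc k) \<le> b k * norm x ^ n" .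
    qed
  qed
  also have "\<dots> = (a 0 + (\<Sum>k<n. b k)) * norm x ^ n" by (simp add: distrib_right sum_distrib_right)
  also have "a 0 + (\<Sum>k<n. b k) = a n" unfolding b_def by (subst sum_lessThan_telescope) simp
  finally have "(a n * norm x ^ n) * norm x \<le> (a n * norm x ^ n) * 1" by (simp add: mult_ac)
  moreover have "a n * norm x ^ n > 0" using pos[of n] x by (intro mult_pos_pos zero_less_power) auto
  ultimately show False using x by (simp only: mult_le_cancel_left_pos)
qed

text \<open>The point \<open>1 / cnj x\<close> is the reflection of \<open>x\<close> in the unit
  circle. For each root factor, the square of \<open>norm (x - r)\<close> exceeds that of
  \<open>norm (1 - r * cnj x)\<close> by \<open>((norm x)^2 - 1) * (1 - (norm r)^2) \<ge> 0\<close>;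
  the product over all roots gives the claim.\<close>

lemma norm_poly_reflect_le:
  fixes p :: "complex poly"
  assumes roots: "\<And>r. poly p r = 0 \<Longrightarrow> norm r \<le> 1" and x: "norm x > 1"
  shows "norm (poly p (1 / cnj x)) \<le> norm (poly p x)"
proof (cases "p = 0")
  case False
  obtain root where p: "smult (lead_coeff p) (\<Prod>i<degree p. [:-root i, 1:]) = p"
    using complex_poly_decompose' by blast
  have poly: "poly p y = lead_coeff p * (\<Prod>i<degree p. y - root i)" for y
    by (subst p[symmetric]) (simp add: poly_prod)
  have "norm (root i) \<le> 1" if "i < degree p" for i
    by (rule roots) (use that in \<open>auto simp: poly\<close>)
  moreover have "norm (1 / cnj x - r) \<le> norm (x - r)" if r: "norm r \<le> 1" for r
  proof -
    have x0: "x \<noteq> 0" using x by auto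
    have "(norm (x - r))\<^sup>2 - (norm (1 - r * cnj x))\<^sup>2 = ((norm x)\<^sup>2 - 1) * (1 - (norm r)\<^sup>2)"
      by (simp add: cmod_power2) (simp add: power2_eq_square algebra_simps)
    moreover have "((norm x)\<^sup>2 - 1) * (1 - (norm r)\<^sup>2) \<ge> 0"
      using x r by (intro mult_nonneg_nonneg) (auto simp: power_le_one one_le_power)
    ultimately have "(norm (1 - r * cnj x))\<^sup>2 \<le> (norm (x - r))\<^sup>2" by linarith
    hence le: "norm (1 - r * cnj x) \<le> norm (x - r)" by (rule power2_le_imp_le) simp
    have "1 / cnj x - r = (1 - r * cnj x) / cnj x" using x0 by (simp add: field_simps)
    hence "norm (1 / cnj x - r) = norm (1 - r * cnj x) / norm x" by (simp add: norm_divide)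
    also have "\<dots> \<le> norm (1 - r * cnj x) / 1" using x by (intro divide_left_mono) auto
    finally show ?thesis using le by simp
  qed
  ultimately show ?thesis
    unfolding poly norm_mult prod_norm[symmetric]
    by (intro mult_left_mono prod_mono) auto
qed simp

text \<open>With \<open>\<zeta> = exp (\<i> * \<theta>)\<close>, \<open>norm \<zeta> > 1\<close>,
  the sum times \<open>2 * \<i>\<close> is
  \<open>\<zeta> * p (\<zeta>^2) - p (1 / \<zeta>^2) / \<zeta>\<close>. As \<open>p\<close> has real
  coefficients, its value at \<open>1 / \<zeta>^2\<close> has the norm of its value at the reflected
  point, at most that of \<open>p (\<zeta>^2)\<close>. So the first term strictly dominates,
  \<open>p (\<zeta>^2)\<close> being nonzero by \<open>Enestrom_Kakeya\<close>.\<close>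

lemma odd_sine_sum_nonzero:
  fixes a :: "nat \<Rightarrow> real"
  assumes a0: "a 0 > 0" and mono: "\<And>k. k < n \<Longrightarrow> a k \<le> a (Suc k)" and im: "Im \<theta> < 0"
  shows "(\<Sum>k\<le>n. of_real (a k) * sin (of_nat (2 * k + 1) * \<theta>)) \<noteq> 0"
proof
  define p where "p = (\<Sum>k\<le>n. monom (complex_of_real (a k)) k)"
  have poly: "poly p y = (\<Sum>k\<le>n. of_real (a k) * y ^ k)" for y
    by (simp add: p_def poly_sum poly_monom)
  define \<zeta> where "\<zeta> = exp (\<i> * \<theta>)"
  have \<zeta>: "norm \<zeta> > 1" "\<zeta> \<noteq> 0" using im by (auto simp: \<zeta>_def)
  have \<zeta>2: "norm (\<zeta>\<^sup>2) > 1" using \<zeta> by (simp add: norm_power one_less_power)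
  have nz: "poly p (\<zeta>\<^sup>2) \<noteq> 0" unfolding poly by (rule Enestrom_Kakeya[of a, OF a0 mono \<zeta>2])
  have "norm (poly p (1 / cnj (\<zeta>\<^sup>2))) \<le> norm (poly p (\<zeta>\<^sup>2))"
  proof (rule norm_poly_reflect_le[OF _ \<zeta>2])
    fix r assume "poly p r = 0"
    thus "norm r \<le> 1" using Enestrom_Kakeya[of a n r, OF a0 mono] unfolding poly by force
  qed
  also have "poly p (1 / cnj (\<zeta>\<^sup>2)) = cnj (poly p (1 / \<zeta>\<^sup>2))" unfolding poly by simp
  finally have le: "norm (poly p (1 / \<zeta>\<^sup>2)) \<le> norm (poly p (\<zeta>\<^sup>2))" by simp
  assume 0: "(\<Sum>k\<le>n. of_real (a k) * sin (of_nat (2 * k + 1) * \<theta>)) = 0"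
  have "2 * \<i> * sin (of_nat (2 * k + 1) * \<theta>) = \<zeta> * (\<zeta>\<^sup>2) ^ k - 1 / \<zeta> * (1 / \<zeta>\<^sup>2) ^ k" for k
  proof -
    have 1: "exp (\<i> * (of_nat (2 * k + 1) * \<theta>)) = \<zeta> ^ (2 * k + 1)"
      unfolding \<zeta>_def exp_of_nat_mult[symmetric] by (simp add: mult_ac)
    have "exp (- (\<i> * (of_nat (2 * k + 1) * \<theta>))) = 1 / \<zeta> ^ (2 * k + 1)"
      unfolding exp_minus 1 by (simp add: inverse_eq_divide)
    hence "2 * \<i> * sin (of_nat (2 * k + 1) * \<theta>) = \<zeta> ^ (2 * k + 1) - 1 / \<zeta> ^ (2 * k + 1)"
      using 1 unfolding sin_exp_eq by simp
    thus ?thesis by (simp add: power_mult power_divide)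
  qed
  hence "2 * \<i> * (\<Sum>k\<le>n. of_real (a k) * sin (of_nat (2 * k + 1) * \<theta>)) =
      (\<Sum>k\<le>n. of_real (a k) * (\<zeta> * (\<zeta>\<^sup>2) ^ k - 1 / \<zeta> * (1 / \<zeta>\<^sup>2) ^ k))"
    unfolding sum_distrib_left by (intro sum.cong refl) (metis mult.left_commute)
  also have "\<dots> = \<zeta> * poly p (\<zeta>\<^sup>2) - 1 / \<zeta> * poly p (1 / \<zeta>\<^sup>2)"
    unfolding poly sum_distrib_left sum_subtractf[symmetric]
    by (intro sum.cong refl) (simp add: algebra_simps)
  finally have "norm (\<zeta> * poly p (\<zeta>\<^sup>2)) = norm (1 / \<zeta> * poly p (1 / \<zeta>\<^sup>2))" using 0 by simp
  hence "norm \<zeta> * norm (poly p (\<zeta>\<^sup>2)) = norm (poly p (1 / \<zeta>\<^sup>2)) / norm \<zeta>"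
    by (simp add: norm_mult norm_divide)
  also have "\<dots> \<le> norm (poly p (1 / \<zeta>\<^sup>2)) / 1" using \<zeta> by (intro divide_left_mono) auto
  also have "\<dots> \<le> 1 * norm (poly p (\<zeta>\<^sup>2))" using le by simp
  finally show False using \<zeta> nz by (simp add: mult_le_cancel_right)
qed

text \<open>With \<open>\<alpha> = \<nu> + 1 / 2\<close> these are the absolute values of the Struve
  coefficients as a series in \<open>z^2\<close>, normalised to start with 1. For
  \<open>\<alpha> = 0\<close> they are those of \<open>sin z / z\<close>.\<close>

primrec struve_coeff :: "real \<Rightarrow> nat \<Rightarrow> real" where
  "struve_coeff \<alpha> 0 = 1"
| "struve_coeff \<alpha> (Suc m) = struve_coeff \<alpha> m / ((2 * real m + 3) * (2 * real m + 2 + 2 * \<alpha>))"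

section \<open>The increasing weight and its odd moments\<close>

locale polya_weight =
  fixes \<alpha> :: real
  assumes \<alpha>: "0 < \<alpha>" "\<alpha> \<le> 1"
begin

definition f :: "real \<Rightarrow> real" where "f t = (1 - t\<^sup>2) powr (\<alpha> - 1)"

text \<open>The half-open interval leaves out the singularity at 1 that occurs for
  \<open>\<alpha> < 1\<close>.\<close>

definition weight :: "real \<Rightarrow> real" where "weight t = indicator {0..<1} t * f t"

lemma f_mono: "0 \<le> s \<Longrightarrow> s \<le> t \<Longrightarrow> t < 1 \<Longrightarrow> f s \<le> f t"
  unfolding f_def using \<alpha> by (intro powr_mono2') (auto simp: power_mono power_less_one_iff abs_square_less_1)

lemma f_pos: "0 \<le> t \<Longrightarrow> t < 1 \<Longrightarrow> f t > 0"
  unfolding f_def by (simp add: power_less_one_iff abs_square_less_1 abs_square_eq_1)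

lemma f_continuous: "continuous_on {0..<1} f"
  unfolding f_def by (intro continuous_intros) (auto simp: power2_eq_1_iff)

lemma weight_nonneg: "0 \<le> weight t"
  by (simp add: weight_def f_def)

lemma weight_measurable [measurable]: "weight \<in> borel_measurable borel"
  unfolding weight_def f_def by measurable

text \<open>Comparison with \<open>(1 - t) powr (\<alpha> - 1)\<close>, whose antiderivative
  \<open>- ((1 - t) powr \<alpha> / \<alpha>)\<close> stays bounded up to 1 because
  \<open>\<alpha> > 0\<close>.\<close>

lemma weight_integrable: "integrable lborel weight"
proof -
  have lim: "((\<lambda>t. - ((1 - t) powr \<alpha> / \<alpha>)) \<longlongrightarrow> - ((1 - (-1)) powr \<alpha> / \<alpha>)) (at_right (-1))"
            "((\<lambda>t. - ((1 - t) powr \<alpha> / \<alpha>)) \<longlongrightarrow> - ((1 - 1) powr \<alpha> / \<alpha>)) (at_left 1)"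
  proof -
    have c: "((\<lambda>t. 1 - t) \<longlongrightarrow> 1 - a) (at a within S)" for a :: real and S
      by (intro tendsto_intros)
    have "((\<lambda>t. (1 - t) powr \<alpha>) \<longlongrightarrow> (1 - (-1)) powr \<alpha>) (at_right (-1))"
      by (rule tendsto_powr'[OF c tendsto_const]) simp
    thus "((\<lambda>t. - ((1 - t) powr \<alpha> / \<alpha>)) \<longlongrightarrow> - ((1 - (-1)) powr \<alpha> / \<alpha>)) (at_right (-1))"
      using \<alpha> by (intro tendsto_minus tendsto_divide tendsto_const) auto
    have "eventually (\<lambda>t::real. 0 \<le> 1 - t) (at_left 1)"
      by (auto simp: eventually_at_filter)
    hence "((\<lambda>t. (1 - t) powr \<alpha>) \<longlongrightarrow> (1 - 1) powr \<alpha>) (at_left 1)"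
      using \<alpha> by (intro tendsto_powr'[OF c tendsto_const]) simp
    thus "((\<lambda>t. - ((1 - t) powr \<alpha> / \<alpha>)) \<longlongrightarrow> - ((1 - 1) powr \<alpha> / \<alpha>)) (at_left 1)"
      using \<alpha> by (intro tendsto_minus tendsto_divide tendsto_const) auto
  qed
  \<comment> \<open>\<open>einterval\<close> is open; starting at \<open>-1\<close> makes it contain
    the point 0.\<close>
  have "set_integrable lborel (einterval (ereal (-1)) (ereal 1)) (\<lambda>t. (1 - t) powr (\<alpha> - 1))"
  proof (rule interval_integral_FTC_nonneg(1))
    show "((\<lambda>t. - ((1 - t) powr \<alpha> / \<alpha>)) has_real_derivative (1 - t) powr (\<alpha> - 1)) (at t)"
      if "ereal (-1) < ereal t" "ereal t < ereal 1" for t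
      using that \<alpha> by (auto intro!: derivative_eq_intros simp: powr_diff field_simps)
    show "isCont (\<lambda>t. (1 - t) powr (\<alpha> - 1)) t"
      if "ereal (-1) < ereal t" "ereal t < ereal 1" for t
      using that by (intro continuous_intros) auto
    show "(((\<lambda>t. - ((1 - t) powr \<alpha> / \<alpha>)) \<circ> real_of_ereal) \<longlongrightarrow> - ((1 - (-1)) powr \<alpha> / \<alpha>)) (at_right (ereal (-1)))"
      using lim(1) by (simp only: ereal_tendsto_simps)
    show "(((\<lambda>t. - ((1 - t) powr \<alpha> / \<alpha>)) \<circ> real_of_ereal) \<longlongrightarrow> - ((1 - 1) powr \<alpha> / \<alpha>)) (at_left (ereal 1))"
      using lim(2) by (simp only: ereal_tendsto_simps)
  qed auto
  hence "integrable lborel (\<lambda>t. indicator {-1<..<1} t *\<^sub>R (1 - t) powr (\<alpha> - 1))"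
    unfolding set_integrable_def by (simp only: einterval_eq)
  thus ?thesis
  proof (rule Bochner_Integration.integrable_bound)
    show "AE t in lborel. norm (weight t) \<le> norm (indicator {-1<..<1} t *\<^sub>R (1 - t) powr (\<alpha> - 1))"
    proof (rule AE_I2)
      fix t :: real
      show "norm (weight t) \<le> norm (indicator {-1<..<1} t *\<^sub>R (1 - t) powr (\<alpha> - 1))"
      proof (cases "0 \<le> t \<and> t < 1")
        case True
        have "t\<^sup>2 \<le> t" using True by (simp add: power2_eq_square mult_left_le)
        hence "f t \<le> (1 - t) powr (\<alpha> - 1)"
          unfolding f_def using \<alpha> True by (intro powr_mono2') auto
        thus ?thesis using True by (simp add: weight_def f_def)
      qed (simp add: weight_def)
    qed
  qed simp
qed

lemma weight_scaleR_integrable: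
  fixes g :: "real \<Rightarrow> 'a :: euclidean_space"
  assumes "continuous_on UNIV g"
  shows "integrable lborel (\<lambda>t. weight t *\<^sub>R g t)"
proof -
  have "bounded (g ` {0..1})"
    by (intro compact_imp_bounded compact_continuous_image continuous_on_subset[OF assms]) auto
  then obtain K where K: "\<And>t. t \<in> {0..1} \<Longrightarrow> norm (g t) \<le> K"
    unfolding bounded_iff by blast
  have [measurable]: "g \<in> borel_measurable borel" using assms by (rule borel_measurable_continuous_onI)
  show ?thesis
  proof (rule Bochner_Integration.integrable_bound[OF integrable_mult_left[OF weight_integrable, of K]])
    show "AE t in lborel. norm (weight t *\<^sub>R g t) \<le> norm (weight t * K)"
    proof (rule AE_I2)
      fix t :: real
      show "norm (weight t *\<^sub>R g t) \<le> norm (weight t * K)"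
      proof (cases "0 \<le> t \<and> t < 1")
        case True
        hence "norm (g t) \<le> \<bar>K\<bar>" using K[of t] by auto
        thus ?thesis using weight_nonneg[of t] by (simp add: abs_mult mult_left_mono)
      qed (simp add: weight_def)
    qed
  qed measurable
qed

text \<open>The weight may be unbounded at 1, so the derivative is asked for only inside the
  interval. The gauge integral then has the stated value, and absolute integrability identifies it
  with the Lebesgue integral.\<close>

lemma weight_integral_FTC:
  fixes F g :: "real \<Rightarrow> real"
  assumes g: "continuous_on UNIV g" and F: "continuous_on {0..1} F"
    and deriv: "\<And>t. 0 < t \<Longrightarrow> t < 1 \<Longrightarrow> (F has_real_derivative f t * g t) (at t)"
  shows "(LINT t|lborel. weight t * g t) = F 1 - F 0"
proof -
  have "((\<lambda>t. weight t * g t) has_integral F 1 - F 0) {0..1}"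
  proof (rule fundamental_theorem_of_calculus_interior[OF _ F])
    fix t :: real assume "t \<in> {0<..<1}"
    thus "(F has_vector_derivative weight t * g t) (at t)"
      using deriv[of t] by (simp add: weight_def has_real_derivative_iff_has_vector_derivative)
  qed simp
  hence "((\<lambda>t. weight t * g t) has_integral F 1 - F 0) UNIV"
    by (rule has_integral_on_superset) (auto simp: weight_def)
  moreover have "integrable lborel (\<lambda>t. weight t * g t)"
    using weight_scaleR_integrable[OF g] by simp
  hence "((\<lambda>t. weight t * g t) has_integral (LINT t|lborel. weight t * g t)) UNIV"
    by (rule has_integral_integral_lborel)
  ultimately show ?thesis using has_integral_unique by blast
qed

definition moment :: "nat \<Rightarrow> real" where "moment m = (LINT t|lborel. weight t * t ^ (2 * m + 1))"

lemma powr_Suc_exponent: "0 \<le> t \<Longrightarrow> t < 1 \<Longrightarrow> (1 - t\<^sup>2) powr \<alpha> = (1 - t\<^sup>2) * f t"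
  using powr_mult_base[of "1 - t\<^sup>2" "\<alpha> - 1"]
  by (simp add: f_def power_le_one)

lemma powr_deriv:
  assumes "0 < t" "t < 1"
  shows "((\<lambda>t. (1 - t\<^sup>2) powr \<alpha>) has_real_derivative f t * (- 2 * \<alpha> * t)) (at t)"
proof -
  have "1 - t\<^sup>2 > 0" using assms by (simp add: power_less_one_iff abs_square_less_1)
  thus ?thesis
    unfolding f_def by (auto intro!: derivative_eq_intros simp: powr_diff field_simps)
qed

lemma powr_cont: "continuous_on {0..1} (\<lambda>t. (1 - t\<^sup>2) powr \<alpha>)"
  using \<alpha> by (intro continuous_on_powr' continuous_intros) (auto simp: power_le_one)

lemma moment_0: "moment 0 = 1 / (2 * \<alpha>)"
proof -
  have "(LINT t|lborel. weight t * t) = - ((1 - 1\<^sup>2) powr \<alpha> / (2 * \<alpha>)) - (- ((1 - 0\<^sup>2) powr \<alpha> / (2 * \<alpha>)))"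
  proof (rule weight_integral_FTC)
    fix t :: real assume "0 < t" "t < 1"
    from powr_deriv[OF this]
    have "((\<lambda>t. - ((1 - t\<^sup>2) powr \<alpha> / (2 * \<alpha>))) has_real_derivative - (f t * (- 2 * \<alpha> * t) / (2 * \<alpha>))) (at t)"
      by (intro DERIV_minus DERIV_cdivide)
    thus "((\<lambda>t. - ((1 - t\<^sup>2) powr \<alpha> / (2 * \<alpha>))) has_real_derivative f t * t) (at t)"
      using \<alpha> by simp
  qed (use \<alpha> in \<open>auto intro!: continuous_intros powr_cont\<close>)
  thus ?thesis by (simp add: moment_def)
qed

text \<open>Integration of the derivative of
  \<open>t ^ (2 * m + 2) * (1 - t^2) powr \<alpha>\<close>, which vanishes at both ends.\<close>

lemma moment_Suc: "(real m + 1 + \<alpha>) * moment (Suc m) = (real m + 1) * moment m"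
proof -
  let ?g = "\<lambda>t. (2 * real m + 2) * t ^ (2 * m + 1) - (2 * real m + 2 + 2 * \<alpha>) * t ^ (2 * m + 3)"
  have "(LINT t|lborel. weight t * ?g t) =
      1 ^ (2 * m + 2) * (1 - 1\<^sup>2) powr \<alpha> - 0 ^ (2 * m + 2) * (1 - 0\<^sup>2) powr \<alpha>"
  proof (rule weight_integral_FTC)
    fix t :: real assume t: "0 < t" "t < 1"
    have "((\<lambda>t. t ^ (2 * m + 2) * (1 - t\<^sup>2) powr \<alpha>) has_real_derivative
       real (2 * m + 2) * t ^ (2 * m + 1) * ((1 - t\<^sup>2) powr \<alpha>) + f t * (- 2 * \<alpha> * t) * t ^ (2 * m + 2)) (at t)"
      using DERIV_mult[OF DERIV_pow[of "2 * m + 2" t] powr_deriv[OF t]] by simp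
    also have "real (2 * m + 2) * t ^ (2 * m + 1) * ((1 - t\<^sup>2) powr \<alpha>) + f t * (- 2 * \<alpha> * t) * t ^ (2 * m + 2)
        = f t * ?g t"
      unfolding powr_Suc_exponent[OF less_imp_le[OF t(1)] t(2)]
      by (simp add: algebra_simps power2_eq_square power3_eq_cube power_add)
    finally show "((\<lambda>t. t ^ (2 * m + 2) * (1 - t\<^sup>2) powr \<alpha>) has_real_derivative f t * ?g t) (at t)" .
  qed (auto intro!: continuous_intros powr_cont)
  hence "(LINT t|lborel. weight t * ?g t) = 0" by simp
  moreover have int: "integrable lborel (\<lambda>t. weight t * t ^ k)" for k
    using weight_scaleR_integrable[of "\<lambda>t. t ^ k"] by (simp add: continuous_intros)
  have "(\<lambda>t. weight t * ?g t) = (\<lambda>t. (2 * real m + 2) * (weight t * t ^ (2 * m + 1))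
      - (2 * real m + 2 + 2 * \<alpha>) * (weight t * t ^ (2 * Suc m + 1)))"
    by (simp add: algebra_simps numeral_3_eq_3)
  hence "(LINT t|lborel. weight t * ?g t) =
      (2 * real m + 2) * moment m - (2 * real m + 2 + 2 * \<alpha>) * moment (Suc m)"
    unfolding moment_def
    by (simp only: Bochner_Integration.integral_diff[OF integrable_mult_right[OF int] integrable_mult_right[OF int]]
          integral_mult_right_zero)
  ultimately show ?thesis by (simp add: algebra_simps)
qed

lemma moment_eq: "moment m = moment 0 * fact (2 * m + 1) * struve_coeff \<alpha> m"
proof (induction m)
  case (Suc m)
  have "real m + 1 + \<alpha> > 0" using \<alpha> by simp
  hence "moment (Suc m) = (real m + 1) * moment m / (real m + 1 + \<alpha>)"
    using moment_Suc[of m] by (simp add: field_simps)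
  also have "fact (2 * Suc m + 1) = (2 * real m + 3) * (2 * real m + 2) * fact (2 * m + 1)"
    by (simp add: algebra_simps)
  hence "(real m + 1) * moment m / (real m + 1 + \<alpha>) =
      moment 0 * fact (2 * Suc m + 1) * struve_coeff \<alpha> (Suc m)"
    using \<alpha> unfolding Suc.IH by (simp add: divide_simps) (simp add: algebra_simps)
  finally show ?case .
qed simp

end

lemma norm_sin_le_exp: "norm (sin (z :: complex)) \<le> exp (norm z)"
proof -
  have "norm (exp (\<i> * z) - exp (- (\<i> * z))) \<le> exp (norm z) + exp (norm z)"
    using norm_exp[of "\<i> * z"] norm_exp[of "- (\<i> * z)"]
    by (intro order_trans[OF norm_triangle_ineq4 add_mono]) (simp_all add: norm_mult)
  thus ?thesis by (simp add: sin_exp_eq norm_divide norm_mult)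
qed

text \<open>Keeping \<open>z\<close> as a factor on the left includes the case \<open>z = 0\<close>.
  The half-open piece differs from the closed interval, where the fundamental theorem applies, by a
  null set.\<close>

lemma integral_sin_piece:
  fixes z :: complex and a b :: real
  assumes "a \<le> b"
  shows "integrable lborel (\<lambda>t. indicator {a..<b} t *\<^sub>R sin (z * of_real t))"
    and "z * (LINT t|lborel. indicator {a..<b} t *\<^sub>R sin (z * of_real t)) = cos (z * of_real a) - cos (z * of_real b)"
proof -
  have eq: "AE t in lborel. indicator {a..b} t *\<^sub>R sin (z * of_real t) = indicator {a..<b} t *\<^sub>R sin (z * of_real t)"
    using AE_lborel_singleton[of b] by eventually_elim (auto simp: indicator_def)
  have I: "integrable lborel (\<lambda>t. indicator {a..b} t *\<^sub>R sin (z * of_real t))"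
    by (rule borel_integrable_compact) (auto intro!: continuous_intros)
  have meas: "(\<lambda>t. sin (z * complex_of_real t)) \<in> borel_measurable borel"
    by (intro borel_measurable_continuous_onI continuous_intros)
  hence meas': "(\<lambda>t. indicator S t *\<^sub>R sin (z * complex_of_real t)) \<in> borel_measurable lborel"
    if "S \<in> sets borel" for S using that by measurable
  show int: "integrable lborel (\<lambda>t. indicator {a..<b} t *\<^sub>R sin (z * of_real t))"
    by (rule integrable_cong_AE_imp[OF I]) (use eq in \<open>auto intro!: meas' elim!: eventually_mono\<close>)
  have "(LINT t|lborel. indicator {a..b} t *\<^sub>R (z * sin (z * of_real t))) = - cos (z * of_real b) - (- cos (z * of_real a))"
  proof (rule integral_FTC_Icc[OF assms])
    fix t :: real
    have "((\<lambda>u. - cos (z * u)) has_field_derivative z * sin (z * of_real t)) (at (of_real t))"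
      by (auto intro!: derivative_eq_intros)
    thus "((\<lambda>t. - cos (z * of_real t)) has_vector_derivative z * sin (z * of_real t)) (at t within {a..b})"
      by (rule has_vector_derivative_real_field)
  qed (auto intro!: continuous_intros)
  also have "(LINT t|lborel. indicator {a..b} t *\<^sub>R (z * sin (z * of_real t))) =
      z * (LINT t|lborel. indicator {a..b} t *\<^sub>R sin (z * of_real t))"
    by (simp flip: integral_mult_right_zero)
  also have "(LINT t|lborel. indicator {a..b} t *\<^sub>R sin (z * of_real t)) = (LINT t|lborel. indicator {a..<b} t *\<^sub>R sin (z * of_real t))"
    by (rule integral_cong_AE) (use eq in \<open>auto intro!: meas'\<close>)
  finally show "z * (LINT t|lborel. indicator {a..<b} t *\<^sub>R sin (z * of_real t)) = cos (z * of_real a) - cos (z * of_real b)"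
    by simp
qed

section \<open>Step function approximation of the weight and of its sine transform\<close>

context polya_weight
begin

text \<open>Sampling at left endpoints keeps the step function below the increasing weight and never
  evaluates \<open>f\<close> at 1.\<close>

definition step :: "nat \<Rightarrow> real \<Rightarrow> real" where
  "step n t = (\<Sum>k\<le>n. f (real k / real (Suc n)) * indicator {real k / real (Suc n)..<(real k + 1) / real (Suc n)} t)"

lemma step_eq: "step n t = indicator {0..<1} t * f (real (nat \<lfloor>real (Suc n) * t\<rfloor>) / real (Suc n))"
proof (cases "0 \<le> t \<and> t < 1")
  case True
  \<comment> \<open>The index of the only piece containing \<open>t\<close>.\<close>
  define j where "j = nat \<lfloor>real (Suc n) * t\<rfloor>"
  have "0 \<le> real (Suc n) * t" using True by simp
  hence j: "real j \<le> real (Suc n) * t" "real (Suc n) * t < real j + 1"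
    unfolding j_def by linarith+
  have "real (Suc n) * t < real (Suc n) * 1" using True by (intro mult_strict_left_mono) auto
  from le_less_trans[OF j(1) this] have "j \<le> n" by simp
  have "t \<in> {real k / real (Suc n)..<(real k + 1) / real (Suc n)} \<longleftrightarrow> k = j" for k
  proof -
    have "t \<in> {real k / real (Suc n)..<(real k + 1) / real (Suc n)} \<longleftrightarrow>
        real k \<le> real (Suc n) * t \<and> real (Suc n) * t < real k + 1"
      by (simp add: field_simps del: of_nat_Suc)
    also have "\<dots> \<longleftrightarrow> k = j" using j by linarith
    finally show ?thesis .
  qed
  hence "step n t = (\<Sum>k\<le>n. if k = j then f (real k / real (Suc n)) else 0)"
    unfolding step_def by (intro sum.cong refl) (simp add: indicator_def)
  also have "\<dots> = f (real j / real (Suc n))" using \<open>j \<le> n\<close> by simp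
  finally show ?thesis using True by (simp add: j_def)
next
  case False
  have "t \<notin> {real k / real (Suc n)..<(real k + 1) / real (Suc n)}" if "k \<le> n" for k
  proof
    assume "t \<in> {real k / real (Suc n)..<(real k + 1) / real (Suc n)}"
    hence t: "real k / real (Suc n) \<le> t" "t < (real k + 1) / real (Suc n)" by auto
    have "0 \<le> real k / real (Suc n)" by simp
    moreover have "(real k + 1) / real (Suc n) \<le> 1" using that by simp
    ultimately show False using t False by linarith
  qed
  hence "step n t = 0" unfolding step_def by (intro sum.neutral ballI) simp
  thus ?thesis using False by simp
qed

lemma floor_step:
  fixes n :: nat
  assumes "0 \<le> t" "t < 1"
  defines "s \<equiv> real (nat \<lfloor>real (Suc n) * t\<rfloor>) / real (Suc n)"
  shows "0 \<le> s" "s \<le> t" "t - inverse (real (Suc n)) \<le> s"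
proof -
  have "0 \<le> real (Suc n) * t" using assms(1) by simp
  hence "real (nat \<lfloor>real (Suc n) * t\<rfloor>) \<le> real (Suc n) * t"
        "real (Suc n) * t - 1 \<le> real (nat \<lfloor>real (Suc n) * t\<rfloor>)" by linarith+
  from divide_right_mono[OF this(1), of "real (Suc n)"] divide_right_mono[OF this(2), of "real (Suc n)"]
  show "s \<le> t" "t - inverse (real (Suc n)) \<le> s"
    unfolding s_def by (simp_all add: diff_divide_distrib inverse_eq_divide del: of_nat_Suc)
qed (simp add: s_def)

lemma step_bounds: "0 \<le> step n t" "step n t \<le> weight t"
  using floor_step[of t n] f_mono[of "real (nat \<lfloor>real (Suc n) * t\<rfloor>) / real (Suc n)" t]
  unfolding step_eq weight_def by (auto simp: indicator_def f_def)

lemma step_measurable [measurable]: "step n \<in> borel_measurable borel"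
  unfolding step_def[abs_def] by measurable

lemma step_tendsto: "(\<lambda>n. step n t) \<longlonglongrightarrow> weight t"
proof (cases "0 \<le> t \<and> t < 1")
  case True
  define s where "s = (\<lambda>n. real (nat \<lfloor>real (Suc n) * t\<rfloor>) / real (Suc n))"
  have "(\<lambda>n. t - inverse (real (Suc n))) \<longlonglongrightarrow> t - 0"
    by (intro tendsto_diff tendsto_const LIMSEQ_inverse_real_of_nat)
  hence lim: "(\<lambda>n. t - inverse (real (Suc n))) \<longlonglongrightarrow> t" by simp
  have bnd: "\<forall>n. t - inverse (real (Suc n)) \<le> s n" "\<forall>n. s n \<le> t" "\<forall>n. 0 \<le> s n"
    unfolding s_def using True floor_step[of t] by blast+
  have lim: "s \<longlonglongrightarrow> t"
    by (rule real_tendsto_sandwich[OF always_eventually[OF bnd(1)] always_eventually[OF bnd(2)] lim tendsto_const])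
  have "(\<lambda>n. f (s n)) \<longlonglongrightarrow> f t"
  proof (rule continuous_on_tendsto_compose[OF f_continuous lim])
    show "\<forall>\<^sub>F n in sequentially. s n \<in> {0..<1}"
      using bnd True by (intro always_eventually allI) (auto intro: le_less_trans)
  qed (use True in auto)
  thus ?thesis using True by (simp add: step_eq weight_def s_def)
qed (simp add: step_eq weight_def)

lemma step_integrable: "integrable lborel (step n)"
  by (rule Bochner_Integration.integrable_bound[OF weight_integrable])
     (use step_bounds weight_nonneg in auto)

text \<open>Dominated convergence with the weight itself as the dominating function.\<close>

lemma step_error_tendsto: "(\<lambda>n. LINT t|lborel. weight t - step n t) \<longlonglongrightarrow> 0"
proof -
  have "(\<lambda>n. LINT t|lborel. step n t) \<longlonglongrightarrow> (LINT t|lborel. weight t)"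
  proof (rule integral_dominated_convergence[OF _ _ weight_integrable])
    show "AE t in lborel. (\<lambda>n. step n t) \<longlonglongrightarrow> weight t" by (simp add: step_tendsto)
    show "AE t in lborel. norm (step n t) \<le> weight t" for n using step_bounds by simp
  qed measurable
  from tendsto_diff[OF tendsto_const[of "LINT t|lborel. weight t"] this]
  show ?thesis using weight_integrable step_integrable by simp
qed

definition sine_transform :: "complex \<Rightarrow> complex" where
  "sine_transform z = (LINT t|lborel. weight t *\<^sub>R sin (z * of_real t))"

definition step_transform :: "nat \<Rightarrow> complex \<Rightarrow> complex" where
  "step_transform n z = (LINT t|lborel. step n t *\<^sub>R sin (z * of_real t))"

lemma sin_line_continuous: "continuous_on UNIV (\<lambda>t. sin (z * complex_of_real t))"
  by (intro continuous_intros)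

lemma step_sin_integrable: "integrable lborel (\<lambda>t. step n t *\<^sub>R sin (z * complex_of_real t))"
proof (rule Bochner_Integration.integrable_bound[OF weight_scaleR_integrable[OF sin_line_continuous[of z]]])
  have [measurable]: "(\<lambda>t. sin (z * complex_of_real t)) \<in> borel_measurable borel"
    using sin_line_continuous by (rule borel_measurable_continuous_onI)
  show "(\<lambda>t. step n t *\<^sub>R sin (z * complex_of_real t)) \<in> borel_measurable lborel" by measurable
  show "AE t in lborel. norm (step n t *\<^sub>R sin (z * complex_of_real t)) \<le> norm (weight t *\<^sub>R sin (z * complex_of_real t))"
    using step_bounds weight_nonneg by (auto intro!: mult_right_mono)
qed

text \<open>On the support of the weight the sine is at most \<open>exp (norm z)\<close>, and the
  step function lies below the weight. The bound depends on \<open>z\<close> only through its norm,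
  hence is uniform on compact sets.\<close>

lemma step_transform_error:
  "norm (step_transform n z - sine_transform z) \<le> exp (norm z) * (LINT t|lborel. weight t - step n t)"
proof -
  have "step_transform n z - sine_transform z = (LINT t|lborel. (step n t - weight t) *\<^sub>R sin (z * of_real t))"
    unfolding step_transform_def sine_transform_def
    using step_sin_integrable weight_scaleR_integrable[OF sin_line_continuous]
    by (simp add: scaleR_diff_left)
  also have "norm \<dots> \<le> (LINT t|lborel. (weight t - step n t) * exp (norm z))"
  proof (rule Bochner_Integration.integral_norm_bound_integral)
    show "integrable lborel (\<lambda>t. (step n t - weight t) *\<^sub>R sin (z * complex_of_real t))"
      using step_sin_integrable weight_scaleR_integrable[OF sin_line_continuous]
      by (simp add: scaleR_diff_left)
    show "integrable lborel (\<lambda>t. (weight t - step n t) * exp (norm z))"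
      using weight_integrable step_integrable by (intro integrable_mult_left Bochner_Integration.integrable_diff)
    fix t :: real
    show "norm ((step n t - weight t) *\<^sub>R sin (z * complex_of_real t)) \<le> (weight t - step n t) * exp (norm z)"
    proof (cases "0 \<le> t \<and> t < 1")
      case True
      hence "norm z * \<bar>t\<bar> \<le> norm z * 1" by (intro mult_left_mono) auto
      hence "norm (sin (z * complex_of_real t)) \<le> exp (norm z)"
        by (intro order_trans[OF norm_sin_le_exp]) (simp add: norm_mult)
      thus ?thesis using step_bounds(2)[of n t] by (simp add: abs_if mult_left_mono)
    qed (simp add: step_eq weight_def)
  qed
  finally show ?thesis by (simp add: mult.commute)
qed

text \<open>Each piece contributes a difference of cosines, that is, twice the sine of
  \<open>z\<close> times half the width times the sine of \<open>z\<close> times the midpoint. The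
  half width is common to all pieces and the midpoints are its odd multiples.\<close>

lemma step_transform_eq:
  "z * step_transform n z =
     2 * sin (z / (2 * of_nat (Suc n))) * (\<Sum>k\<le>n. of_real (f (real k / real (Suc n))) * sin (of_nat (2 * k + 1) * (z / (2 * of_nat (Suc n)))))"
proof -
  let ?I = "\<lambda>k::nat. {real k / real (Suc n)..<(real k + 1) / real (Suc n)}"
  have le: "real k / real (Suc n) \<le> (real k + 1) / real (Suc n)" for k :: nat
    by (intro divide_right_mono) auto
  note piece = integral_sin_piece[OF le]
  have "step_transform n z = (LINT t|lborel. (\<Sum>k\<le>n. f (real k / real (Suc n)) *\<^sub>R (indicator (?I k) t *\<^sub>R sin (z * of_real t))))"
    unfolding step_transform_def step_def by (simp only: scaleR_sum_left scaleR_scaleR)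
  also have "\<dots> = (\<Sum>k\<le>n. f (real k / real (Suc n)) *\<^sub>R (LINT t|lborel. indicator (?I k) t *\<^sub>R sin (z * of_real t)))"
    by (subst Bochner_Integration.integral_sum)
       (intro integrable_scaleR_right piece(1), simp only: integral_scaleR_right)
  finally have "z * step_transform n z = (\<Sum>k\<le>n. of_real (f (real k / real (Suc n))) *
      (z * (LINT t|lborel. indicator (?I k) t *\<^sub>R sin (z * of_real t))))"
    by (simp add: sum_distrib_left scaleR_conv_of_real mult.left_commute)
  also have "\<dots> = (\<Sum>k\<le>n. of_real (f (real k / real (Suc n))) *
      (cos (z * of_real (real k / real (Suc n))) - cos (z * of_real ((real k + 1) / real (Suc n)))))"
    unfolding piece(2) ..
  also have "\<dots> = (\<Sum>k\<le>n. of_real (f (real k / real (Suc n))) *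
      (2 * sin (z / (2 * of_nat (Suc n))) * sin (of_nat (2 * k + 1) * (z / (2 * of_nat (Suc n))))))"
  proof (intro sum.cong refl arg_cong2[of _ _ _ _ "(*)"])
    fix k :: nat
    have nz: "complex_of_nat (Suc n) \<noteq> 0" by (simp del: of_nat_Suc)
    have 1: "(z * of_real (real k / real (Suc n)) + z * of_real ((real k + 1) / real (Suc n))) / 2 =
       of_nat (2 * k + 1) * (z / (2 * of_nat (Suc n)))"
    proof -
      have "complex_of_nat (2 * k + 1) = 2 * of_nat k + 1" by simp
      thus ?thesis using nz by (simp only:) (simp add: field_simps del: of_nat_Suc)
    qed
    have 2: "(z * of_real ((real k + 1) / real (Suc n)) - z * of_real (real k / real (Suc n))) / 2 =
       z / (2 * of_nat (Suc n))"
      using nz by (simp add: field_simps del: of_nat_Suc)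
    show "cos (z * of_real (real k / real (Suc n))) - cos (z * of_real ((real k + 1) / real (Suc n))) =
      2 * sin (z / (2 * of_nat (Suc n))) * sin (of_nat (2 * k + 1) * (z / (2 * of_nat (Suc n))))"
      unfolding cos_diff_cos 1 2 by (simp only: mult_ac)
  qed
  finally show ?thesis by (simp add: sum_distrib_left mult_ac)
qed

text \<open>The first sine in \<open>step_transform_eq\<close> has only real zeros. The remaining
  sum has positive increasing coefficients \<open>f (k / Suc n)\<close>, so
  \<open>odd_sine_sum_nonzero\<close> applies.\<close>

lemma step_transform_nonzero:
  assumes "Im z < 0"
  shows "step_transform n z \<noteq> 0"
proof -
  define \<theta> where "\<theta> = z / (2 * of_nat (Suc n))"
  have \<theta>: "\<theta> = z / of_real (2 * real (Suc n))" by (simp add: \<theta>_def)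
  have im: "Im \<theta> < 0" unfolding \<theta> Im_divide_of_real using assms by (intro divide_neg_pos) auto
  have "sin \<theta> \<noteq> 0"
  proof
    assume "sin \<theta> = 0"
    then obtain m where "\<theta> = of_real (real_of_int m * pi)" unfolding sin_eq_0 by auto
    with im show False by simp
  qed
  moreover have "(\<Sum>k\<le>n. of_real (f (real k / real (Suc n))) * sin (of_nat (2 * k + 1) * \<theta>)) \<noteq> 0"
  proof (rule odd_sine_sum_nonzero[where a = "\<lambda>k. f (real k / real (Suc n))", OF _ _ im])
    show "0 < f (real 0 / real (Suc n))" using f_pos[of 0] by simp
    fix k assume "k < n"
    thus "f (real k / real (Suc n)) \<le> f (real (Suc k) / real (Suc n))"
      by (intro f_mono divide_right_mono) auto
  qed
  ultimately have "z * step_transform n z \<noteq> 0"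
    unfolding step_transform_eq \<theta>_def by simp
  thus ?thesis by auto
qed

lemma step_transform_holomorphic: "step_transform n holomorphic_on {z. Im z < 0}"
proof (rule holomorphic_transform)
  show "(\<lambda>z. 2 * sin (z / (2 * of_nat (Suc n))) *
      (\<Sum>k\<le>n. of_real (f (real k / real (Suc n))) * sin (of_nat (2 * k + 1) * (z / (2 * of_nat (Suc n))))) / z)
    holomorphic_on {z. Im z < 0}"
    by (intro holomorphic_intros) (auto simp del: of_nat_Suc)
  fix z assume "z \<in> {z. Im z < 0}"
  hence "z \<noteq> 0" by auto
  thus "2 * sin (z / (2 * of_nat (Suc n))) *
      (\<Sum>k\<le>n. of_real (f (real k / real (Suc n))) * sin (of_nat (2 * k + 1) * (z / (2 * of_nat (Suc n))))) / z = step_transform n z"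
    unfolding step_transform_eq[symmetric] by simp
qed

lemma step_transform_uniform_limit:
  assumes "compact K"
  shows "uniform_limit K step_transform sine_transform sequentially"
proof -
  obtain B where B: "\<And>z. z \<in> K \<Longrightarrow> norm z \<le> B"
    using compact_imp_bounded[OF assms] unfolding bounded_iff by blast
  have "uniform_limit K (\<lambda>n z. step_transform n z - sine_transform z) (\<lambda>_. 0) sequentially"
  proof (rule uniform_limit_null_comparison)
    show "\<forall>\<^sub>F n in sequentially. \<forall>z\<in>K. norm (step_transform n z - sine_transform z) \<le>
            exp B * (LINT t|lborel. weight t - step n t)"
    proof (intro always_eventually allI ballI)
      fix n z assume "z \<in> K"
      have "0 \<le> (LINT t|lborel. weight t - step n t)"
        by (rule Bochner_Integration.integral_nonneg) (use step_bounds in simp)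
      thus "norm (step_transform n z - sine_transform z) \<le> exp B * (LINT t|lborel. weight t - step n t)"
        using B[OF \<open>z \<in> K\<close>] by (intro order_trans[OF step_transform_error mult_right_mono]) auto
    qed
    have "(\<lambda>n. exp B * (LINT t|lborel. weight t - step n t)) \<longlonglongrightarrow> exp B * 0"
      by (intro tendsto_mult tendsto_const step_error_tendsto)
    thus "uniform_limit K (\<lambda>n z. exp B * (LINT t|lborel. weight t - step n t)) (\<lambda>_. 0) sequentially"
      unfolding uniform_limit_iff tendsto_iff by simp
  qed
  thus ?thesis by (simp add: uniform_limit_iff dist_norm)
qed

end

section \<open>The Struve function\<close>

text \<open>The even terms vanish because \<open>sin_coeff\<close> does. The free factor
  \<open>c\<close> serves both for the sine series and for its integral against the weight, where
  \<open>c\<close> gives the moments.\<close>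

lemma sin_coeff_sums_odd:
  fixes c :: "nat \<Rightarrow> real" and z S :: complex
  assumes "(\<lambda>n. of_real (sin_coeff n * c n) * z ^ n) sums S"
  shows "(\<lambda>m. z * (of_real ((-1) ^ m * (c (2 * m + 1) / fact (2 * m + 1))) * (z\<^sup>2) ^ m)) sums S"
proof -
  have mono: "strict_mono (\<lambda>m::nat. 2 * m + 1)" by (rule strict_monoI) simp
  have "(\<lambda>m. of_real (sin_coeff (2 * m + 1) * c (2 * m + 1)) * z ^ (2 * m + 1)) sums S"
    using assms
  proof (subst sums_mono_reindex[OF mono])
    fix n :: nat assume "n \<notin> range (\<lambda>m. 2 * m + 1)"
    hence "even n" by (metis oddE rangeI)
    thus "of_real (sin_coeff n * c n) * z ^ n = 0" by (simp add: sin_coeff_def)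
  qed
  moreover have "sin_coeff (2 * m + 1) = (-1) ^ m / fact (2 * m + 1)" for m
    by (simp add: sin_coeff_def)
  moreover have "z ^ (2 * m + 1) = z * (z\<^sup>2) ^ m" for m by (simp add: power_mult)
  moreover have "of_real (a / b * c) * (z * w) = z * (of_real (a * (c / b)) * w)" for a b c :: real and w
    by simp
  ultimately show ?thesis by (simp only:)
qed

lemma sin_sums_odd:
  "(\<lambda>m. z * (of_real ((-1) ^ m * (1 / fact (2 * m + 1))) * (z\<^sup>2) ^ m)) sums sin (z :: complex)"
  using sin_converges[of z] by (intro sin_coeff_sums_odd[where c = "\<lambda>_. 1"]) (simp add: scaleR_conv_of_real)

lemma struve_coeff_0_eq: "struve_coeff 0 m = 1 / fact (2 * m + 1)"
proof (induction m)
  case (Suc m)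
  have "fact (2 * Suc m + 1) = (2 * real m + 3) * (2 * real m + 2) * fact (2 * m + 1)"
    by (simp add: algebra_simps)
  thus ?case unfolding struve_coeff.simps Suc.IH by (simp add: mult_ac)
qed simp

lemma struve_coeff_pos: "\<alpha> \<ge> 0 \<Longrightarrow> struve_coeff \<alpha> m > 0"
  by (induction m) (auto intro!: divide_pos_pos mult_pos_pos add_pos_nonneg)

text \<open>The denominator of each recursion step is at least
  \<open>(2 * m + 2) * (2 * m + 1)\<close>, the factor by which the factorial grows.\<close>

lemma struve_coeff_le:
  assumes "\<alpha> \<ge> 0"
  shows "struve_coeff \<alpha> m \<le> 1 / fact (2 * m)"
proof (induction m)
  case (Suc m)
  have "(2 * real m + 2) * (2 * real m + 1) \<le> (2 * real m + 3) * (2 * real m + 2 + 2 * \<alpha>)"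
    using assms by (subst mult.commute, intro mult_mono) auto
  hence "struve_coeff \<alpha> (Suc m) \<le> 1 / fact (2 * m) / ((2 * real m + 2) * (2 * real m + 1))"
    unfolding struve_coeff.simps using Suc.IH struve_coeff_pos[OF assms, of m]
    by (intro frac_le) (auto intro: less_imp_le mult_pos_pos)
  also have "\<dots> = 1 / fact (2 * Suc m)" by (simp add: field_simps)
  finally show ?case .
qed simp

lemma struve_pos_coeff_series: "\<alpha> \<ge> 0 \<Longrightarrow> pos_coeff_series (struve_coeff \<alpha>) 1 1"
  by unfold_locales (use struve_coeff_pos struve_coeff_le in auto)

section \<open>The sine transform as a power series, and its zeros\<close>

context polya_weight
begin

text \<open>Termwise integration of the sine series, justified by the summable bound
  \<open>weight t * norm z ^ n / fact n\<close>, gives a series in the odd moments, which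
  \<open>moment_eq\<close> turns into \<open>struve_coeff\<close>. The argument divides by
  \<open>z\<close>, so \<open>z = 0\<close> is separate.\<close>

lemma sine_transform_eq:
  "sine_transform z = of_real (moment 0) * z * alt_series (struve_coeff \<alpha>) (z\<^sup>2)"
proof (cases "z = 0")
  case False
  define g where "g = (\<lambda>n t. weight t *\<^sub>R (sin_coeff n *\<^sub>R (z * complex_of_real t) ^ n))"
  have int: "integrable lborel (g n)" for n
    unfolding g_def by (intro weight_scaleR_integrable continuous_intros)
  have ng: "norm (g n t) \<le> weight t * (norm z ^ n / fact n)" for n t
  proof (cases "0 \<le> t \<and> t < 1")
    case True
    have "norm (sin_coeff n *\<^sub>R (z * complex_of_real t) ^ n) = \<bar>sin_coeff n\<bar> * (norm z ^ n * t ^ n)"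
      using True by (simp add: norm_mult norm_power power_mult_distrib)
    also have "\<dots> \<le> (1 / fact n) * (norm z ^ n * 1)"
      using True by (intro mult_mono) (auto simp: sin_coeff_def power_le_one)
    finally have "norm (sin_coeff n *\<^sub>R (z * complex_of_real t) ^ n) \<le> norm z ^ n / fact n" by simp
    from mult_left_mono[OF this weight_nonneg[of t]] show ?thesis
      using weight_nonneg[of t] unfolding g_def norm_scaleR[of "weight t"] by simp
  qed (simp add: g_def weight_def)
  have exp: "summable (\<lambda>n. norm z ^ n / fact n)"
    using summable_exp[of "norm z"] by (simp add: divide_inverse mult.commute)
  have "(\<lambda>n. integral\<^sup>L lborel (g n)) sums (\<integral>t. (\<Sum>n. g n t) \<partial>lborel)"
  proof (rule sums_integral[OF int])
    show "AE t in lborel. summable (\<lambda>n. norm (g n t))"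
      by (intro AE_I2 summable_comparison_test[OF exI[of _ 0] summable_mult[OF exp]]) (use ng in auto)
    show "summable (\<lambda>n. \<integral>t. norm (g n t) \<partial>lborel)"
    proof (rule summable_comparison_test)
      show "summable (\<lambda>n. (\<integral>t. weight t \<partial>lborel) * (norm z ^ n / fact n))" using exp by (rule summable_mult)
      have "(\<integral>t. norm (g n t) \<partial>lborel) \<le> (\<integral>t. weight t * (norm z ^ n / fact n) \<partial>lborel)" for n
        by (intro integral_mono integrable_norm int integrable_mult_left weight_integrable ng)
      hence "norm (\<integral>t. norm (g n t) \<partial>lborel) \<le> (\<integral>t. weight t \<partial>lborel) * (norm z ^ n / fact n)" for n
        by (simp add: integral_nonneg)
      thus "\<exists>N. \<forall>n\<ge>N. norm (\<integral>t. norm (g n t) \<partial>lborel) \<le> (\<integral>t. weight t \<partial>lborel) * (norm z ^ n / fact n)"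
        by blast
    qed
  qed
  also have "(\<lambda>t. \<Sum>n. g n t) = (\<lambda>t. weight t *\<^sub>R sin (z * of_real t))"
    unfolding g_def using sums_unique[OF sums_scaleR_right[OF sin_converges]] by metis
  also have "integral\<^sup>L lborel \<dots> = sine_transform z" by (simp add: sine_transform_def)
  also have "(\<lambda>n. integral\<^sup>L lborel (g n)) = (\<lambda>n. of_real (sin_coeff n * (\<integral>t. weight t * t ^ n \<partial>lborel)) * z ^ n)"
  proof
    fix n
    have "g n = (\<lambda>t. (of_real (sin_coeff n) * z ^ n) * of_real (weight t * t ^ n))"
      by (auto simp: g_def fun_eq_iff scaleR_conv_of_real power_mult_distrib)
    hence "integral\<^sup>L lborel (g n) = (of_real (sin_coeff n) * z ^ n) * of_real (\<integral>t. weight t * t ^ n \<partial>lborel)"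
      by (simp only: integral_mult_right_zero integral_complex_of_real)
    thus "integral\<^sup>L lborel (g n) = of_real (sin_coeff n * (\<integral>t. weight t * t ^ n \<partial>lborel)) * z ^ n"
      by (simp add: mult_ac)
  qed
  finally have "(\<lambda>m. z * (of_real ((-1) ^ m * (moment m / fact (2 * m + 1))) * (z\<^sup>2) ^ m)) sums sine_transform z"
    unfolding moment_def by (rule sin_coeff_sums_odd)
  moreover have "moment m / fact (2 * m + 1) = moment 0 * struve_coeff \<alpha> m" for m
    by (subst moment_eq) simp
  ultimately have "(\<lambda>m. z * (of_real ((-1) ^ m * (moment 0 * struve_coeff \<alpha> m)) * (z\<^sup>2) ^ m)) sums sine_transform z"
    by (simp only:)
  hence "(\<lambda>m. (of_real (moment 0) * z) * (of_real ((-1) ^ m * struve_coeff \<alpha> m) * (z\<^sup>2) ^ m)) sums sine_transform z"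
    by (simp add: mult_ac)
  moreover have nz: "of_real (moment 0) * z \<noteq> 0" using False \<alpha> by (simp add: moment_0)
  ultimately have "(\<lambda>m. of_real ((-1) ^ m * struve_coeff \<alpha> m) * (z\<^sup>2) ^ m) sums (sine_transform z / (of_real (moment 0) * z))"
    by (rule sums_mult_D)
  hence "alt_series (struve_coeff \<alpha>) (z\<^sup>2) = sine_transform z / (of_real (moment 0) * z)"
    unfolding alt_series_def by (simp add: sums_iff)
  thus ?thesis using nz by simp
qed (simp add: sine_transform_def)

text \<open>Hurwitz's theorem in the lower half-plane: the step transforms have no zeros there and
  converge uniformly on compact sets.\<close>

lemma sine_transform_nonzero:
  assumes z: "Im z < 0"
  shows "sine_transform z \<noteq> 0"
proof -
  interpret pos_coeff_series "struve_coeff \<alpha>" 1 1 using \<alpha> by (intro struve_pos_coeff_series) simp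
  have comp: "(\<lambda>z. G (z\<^sup>2)) holomorphic_on S" for S
    by (rule holomorphic_on_compose_gen[OF _ hol, unfolded o_def]) (auto intro!: holomorphic_intros)
  have holS: "sine_transform holomorphic_on S" for S
    unfolding sine_transform_eq[abs_def] by (intro holomorphic_intros comp)
  show ?thesis
  proof (rule Hurwitz_no_zeros[of "{z. Im z < 0}" step_transform sine_transform z])
    show "open {z. Im z < 0}" by (rule open_halfspace_Im_lt)
    show "connected {z. Im z < 0}" by (intro convex_connected convex_halfspace_Im_lt)
    \<comment> \<open>Along points \<open>y n\<close> tending to 0 a constant value would have to be
      \<open>sine_transform 0 = 0\<close>. Then \<open>G\<close> would vanish at all
      \<open>(y n)^2\<close>, and so at 0, where it is nonzero.\<close>
    show "\<not> sine_transform constant_on {z. Im z < 0}"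
    proof
      assume "sine_transform constant_on {z. Im z < 0}"
      then obtain c where c: "\<And>z. Im z < 0 \<Longrightarrow> sine_transform z = c" by (auto simp: constant_on_def)
      define y where "y = (\<lambda>n. - \<i> * of_real (inverse (real (Suc n))))"
      have y: "Im (y n) < 0" for n by (simp add: y_def)
      have "y \<longlonglongrightarrow> - \<i> * of_real 0"
        unfolding y_def by (intro tendsto_intros LIMSEQ_inverse_real_of_nat)
      hence lim: "y \<longlonglongrightarrow> 0" by simp
      have "isCont sine_transform 0" "isCont (\<lambda>z. G (z\<^sup>2)) 0"
        using holS[of UNIV] comp[of UNIV]
        by (auto dest!: holomorphic_on_imp_continuous_on simp: continuous_on_eq_continuous_at)
      hence lims: "(\<lambda>n. sine_transform (y n)) \<longlonglongrightarrow> sine_transform 0" "(\<lambda>n. G ((y n)\<^sup>2)) \<longlonglongrightarrow> G (0\<^sup>2)"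
        using isCont_tendsto_compose[OF _ lim] by blast+
      have "c = 0" using LIMSEQ_unique[OF lims(1)] c[OF y] by (simp add: sine_transform_eq)
      hence "G ((y n)\<^sup>2) = 0" for n
        using c[OF y, of n] \<alpha> y[of n] by (auto simp: sine_transform_eq moment_0)
      hence "G 0 = 0" using LIMSEQ_unique[OF lims(2)] by simp
      thus False using f0 by simp
    qed
  qed (use z step_transform_holomorphic step_transform_uniform_limit step_transform_nonzero holS in auto)
qed

end

text \<open>If \<open>z G(z^2)\<close> has only real zeros, then every root \<open>w\<close> of
  \<open>G\<close> is the square of a real number, and \<open>w\<close> is nonzero because
  \<open>G\<close> is nonzero at 0.\<close>

lemma struve_pos_root_series:
  assumes "0 \<le> \<alpha>" "\<alpha> \<le> 1"
  shows "pos_root_series (struve_coeff \<alpha>) 1 1"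
proof -
  interpret pos_coeff_series "struve_coeff \<alpha>" 1 1 using assms by (intro struve_pos_coeff_series)
  have real: "Im z = 0" if z: "G (z\<^sup>2) = 0" for z
  proof (cases "\<alpha> = 0")
    case True
    have "(\<lambda>m. z * (c m * (z\<^sup>2) ^ m)) sums (z * G (z\<^sup>2))"
      unfolding G_eq by (intro sums_mult summable_sums summable_G)
    moreover have "(\<lambda>m. z * (c m * (z\<^sup>2) ^ m)) sums sin z"
      using sin_sums_odd[of z] unfolding c_def by (simp only: True struve_coeff_0_eq)
    ultimately have "sin z = 0" using z by (simp add: sums_iff)
    thus ?thesis by (auto simp: sin_eq_0)
  next
    case False
    interpret polya_weight \<alpha> using False assms by unfold_locales auto
    \<comment> \<open>The transform is odd, so the zero-free lower half-plane excludes zeros in the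
      upper one too.\<close>
    have "sine_transform z = 0" "sine_transform (- z) = 0" using z by (simp_all add: sine_transform_eq)
    thus ?thesis using sine_transform_nonzero[of z] sine_transform_nonzero[of "- z"] by force
  qed
  show ?thesis
  proof unfold_locales
    fix w assume w: "G w = 0"
    define z where "z = csqrt w"
    have w_eq: "w = z\<^sup>2" by (simp add: z_def)
    have "Im z = 0" using real w by (simp add: w_eq)
    hence z: "z = of_real (Re z)" by (simp add: complex_eq_iff)
    have "w \<noteq> 0" using w f0 by auto
    hence "Re z \<noteq> 0" using z w_eq by auto
    moreover have "w = of_real ((Re z)\<^sup>2)" unfolding w_eq by (subst z) simp
    ultimately show "w \<in> \<real> \<and> Re w > 0" by simp
  qed
qed

text \<open>The bound on \<open>\<nu>\<close> keeps all Gamma arguments in the right half-plane, so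
  \<open>Gamma\<close> is nonzero there and its functional equation yields the recursion of
  \<open>struve_coeff\<close>. The powers of 4 cancel those from
  \<open>(z / 2) ^ (2 * m)\<close>.\<close>

lemma struve_H_eq:
  assumes \<nu>: "- 1 / 2 \<le> \<nu>" and K: "K = 1 / (Gamma (3 / 2) * Gamma (of_real \<nu> + 3 / 2))"
  shows "K \<noteq> 0"
    and "struve_H (of_real \<nu>) z = K * (z / 2) powr of_real (\<nu> + 1) * alt_series (struve_coeff (\<nu> + 1 / 2)) (z\<^sup>2)"
proof -
  interpret pos_coeff_series "struve_coeff (\<nu> + 1 / 2)" 1 1 using \<nu> by (intro struve_pos_coeff_series) simp
  have nonpos: "w \<notin> \<int>\<^sub>\<le>\<^sub>0" if "Re w > 0" for w :: complex
    using that by (auto elim!: nonpos_Ints_cases)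
  have gpos: "Gamma w \<noteq> 0" if "Re w > 0" for w :: complex
    using nonpos[OF that] by (simp add: Gamma_eq_zero_iff)
  show "K \<noteq> 0" unfolding K using \<nu> gpos[of "3 / 2"] gpos[of "of_real \<nu> + 3 / 2"] by simp
  have coeff: "1 / (Gamma (of_nat m + 3 / 2) * Gamma (of_nat m + of_real \<nu> + 3 / 2)) =
      K * (4 ^ m * of_real (struve_coeff (\<nu> + 1 / 2) m))" for m
  proof (induction m)
    case (Suc m)
    have r: "Re (of_nat m + 3 / 2) > 0" "Re (of_nat m + of_real \<nu> + 3 / 2) > 0" using \<nu> by auto
    have "Gamma (of_nat (Suc m) + 3 / 2) = (of_nat m + 3 / 2) * (Gamma (of_nat m + 3 / 2) :: complex)"
      using Gamma_plus1[OF nonpos[OF r(1)]] by (simp add: add_ac)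
    moreover have "Gamma (of_nat (Suc m) + of_real \<nu> + 3 / 2) =
        (of_nat m + of_real \<nu> + 3 / 2) * (Gamma (of_nat m + of_real \<nu> + 3 / 2) :: complex)"
      using Gamma_plus1[OF nonpos[OF r(2)]] by (simp add: add_ac)
    ultimately have "1 / (Gamma (of_nat (Suc m) + 3 / 2) * Gamma (of_nat (Suc m) + of_real \<nu> + 3 / 2)) =
       1 / (Gamma (of_nat m + 3 / 2) * Gamma (of_nat m + of_real \<nu> + 3 / 2)) /
         ((of_nat m + 3 / 2) * (of_nat m + of_real \<nu> + 3 / 2) :: complex)"
      by (simp add: mult_ac)
    also have "\<dots> = K * (4 ^ m * of_real (struve_coeff (\<nu> + 1 / 2) m)) /
         ((of_nat m + 3 / 2) * (of_nat m + of_real \<nu> + 3 / 2))"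
      unfolding Suc.IH ..
    also have "(of_nat m + 3 / 2) * (of_nat m + of_real \<nu> + 3 / 2) =
        complex_of_real ((2 * real m + 3) * (2 * real m + 2 + 2 * (\<nu> + 1 / 2))) / 4"
      by (simp add: algebra_simps)
    also have "K * (4 ^ m * of_real (struve_coeff (\<nu> + 1 / 2) m)) / \<dots> =
        K * (4 ^ Suc m * of_real (struve_coeff (\<nu> + 1 / 2) (Suc m)))"
      by simp
    finally show ?case .
  qed (simp add: K)
  have "(-1) ^ m / (Gamma (of_nat m + 3 / 2) * Gamma (of_nat m + of_real \<nu> + 3 / 2)) * (z / 2) ^ (2 * m) =
      K * (c m * (z\<^sup>2) ^ m)" for m
  proof -
    have "(-1) ^ m / (Gamma (of_nat m + 3 / 2) * Gamma (of_nat m + of_real \<nu> + 3 / 2)) * (z / 2) ^ (2 * m) =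
        (-1) ^ m * (1 / (Gamma (of_nat m + 3 / 2) * Gamma (of_nat m + of_real \<nu> + 3 / 2))) * (z\<^sup>2 / 4) ^ m"
      by (simp add: power_mult power_divide)
    also have "\<dots> = K * (c m * (z\<^sup>2) ^ m)"
      unfolding coeff c_def by (simp add: power_divide)
    finally show ?thesis .
  qed
  hence "(\<Sum>m. (-1) ^ m / (Gamma (of_nat m + 3 / 2) * Gamma (of_nat m + of_real \<nu> + 3 / 2)) * (z / 2) ^ (2 * m)) = K * G (z\<^sup>2)"
    unfolding G_eq using suminf_mult[OF summable_G[of "z\<^sup>2"], of K] by simp
  thus "struve_H (of_real \<nu>) z = K * (z / 2) powr of_real (\<nu> + 1) * G (z\<^sup>2)"
    unfolding struve_H_def by (simp add: mult_ac)
qed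

theorem theorem5:
  fixes \<nu> :: real
  assumes "\<nu> \<in> {- 1 / 2 .. 1 / 2}"
  shows
    "((\<lambda>n. 1 / pos_zero (struve_H (of_real \<nu>)) n ^ 2) sums
        (1 / (3 * (2 * \<nu> + 3)))) \<and>
     ((\<lambda>n. 1 / pos_zero (struve_H (of_real \<nu>)) n ^ 4) sums
        ((7 - 2 * \<nu>) / (45 * (2 * \<nu> + 3) ^ 2 * (2 * \<nu> + 5)))) \<and>
     ((\<lambda>n. 1 / pos_zero (deriv (struve_H (of_real \<nu>))) n ^ 2) sums
        ((\<nu> + 3) / (3 * (\<nu> + 1) * (2 * \<nu> + 3)))) \<and>
     ((\<lambda>n. 1 / pos_zero (deriv (struve_H (of_real \<nu>))) n ^ 4) sums
        ((- 2 * \<nu> ^ 3 - 5 * \<nu> ^ 2 + 72 * \<nu> + 135) /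
         (45 * (\<nu> + 1) ^ 2 * (2 * \<nu> + 3) ^ 2 * (2 * \<nu> + 5)))) \<and>
     (0 < \<nu> \<longrightarrow>
       ((\<lambda>n. 1 / pos_zero (deriv (deriv (struve_H (of_real \<nu>)))) n ^ 2) sums
          ((\<nu> + 2) * (\<nu> + 3) / (3 * \<nu> * (\<nu> + 1) * (2 * \<nu> + 3)))) \<and>
       ((\<lambda>n. 1 / pos_zero (deriv (deriv (struve_H (of_real \<nu>)))) n ^ 4) sums
          ((- 2 * \<nu> ^ 5 - 13 * \<nu> ^ 4 + 92 * \<nu> ^ 3 + 763 * \<nu> ^ 2 + 1500 * \<nu> + 900) /
           (45 * \<nu> ^ 2 * (\<nu> + 1) ^ 2 * (2 * \<nu> + 3) ^ 2 * (2 * \<nu> + 5)))))"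
proof -
  have \<nu>: "- 1 / 2 \<le> \<nu>" "\<nu> \<le> 1 / 2" using assms by auto
  define d where "d = struve_coeff (\<nu> + 1 / 2)"
  \<comment> \<open>Each derivative applies the Euler operator with the exponent reached so far,
    first \<open>\<nu> + 1\<close> and then \<open>\<nu>\<close>.\<close>
  define d' where "d' = (\<lambda>m. (2 * real m + (\<nu> + 1)) * d m)"
  define d'' where "d'' = (\<lambda>m. (2 * real m + \<nu>) * d' m)"
  define K :: complex where "K = 1 / (Gamma (3 / 2) * Gamma (of_real \<nu> + 3 / 2))"
  note H = struve_H_eq[OF \<nu>(1) K_def, folded d_def]
  interpret D: pos_root_series d 1 1
    unfolding d_def using \<nu> by (intro struve_pos_root_series) auto
  interpret D': pos_root_series d' "1 * (2 + (\<nu> + 1))" "2 * 1"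
    unfolding d'_def by (rule D.euler_operator_pos_root_series) (use \<nu> in simp)
  have H': "deriv (struve_H (of_real \<nu>)) z = K / 2 * (z / 2) powr of_real \<nu> * alt_series d' (z\<^sup>2)"
    if "Re z > 0" for z
    using D.deriv_powr_times_G[OF H(2) that] by (simp add: d'_def)
  have H'': "deriv (deriv (struve_H (of_real \<nu>))) z =
      K / 2 / 2 * (z / 2) powr of_real (\<nu> - 1) * alt_series d'' (z\<^sup>2)" if "Re z > 0" for z
    using D'.deriv_powr_times_G[OF H' that] by (simp only: d''_def)
  have pos: "2 * \<nu> + 3 > 0" "2 * \<nu> + 5 > 0" "\<nu> + 1 > 0" using \<nu> by auto
  have "2 * real 0 + 2 + 2 * (\<nu> + 1 / 2) = 2 * \<nu> + 3" "2 * real 1 + 2 + 2 * (\<nu> + 1 / 2) = 2 * \<nu> + 5"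
    by simp_all
  hence d: "d 0 = 1" "d 1 = 1 / (3 * (2 * \<nu> + 3))" "d 2 = 1 / (3 * (2 * \<nu> + 3)) / (5 * (2 * \<nu> + 5))"
    by (simp_all add: d_def numeral_2_eq_2 add.commute)
  have d': "d' 0 = \<nu> + 1" "d' 1 = (\<nu> + 3) * d 1" "d' 2 = (\<nu> + 5) * d 2"
    by (simp_all add: d'_def d(1))
  have d'': "d'' 0 = \<nu> * (\<nu> + 1)" "d'' 1 = (\<nu> + 2) * (\<nu> + 3) * d 1" "d'' 2 = (\<nu> + 4) * (\<nu> + 5) * d 2"
    unfolding d''_def d' by simp_all
  have e: "d 1 / d 0 = 1 / (3 * (2 * \<nu> + 3))"
      "(d 1 / d 0)\<^sup>2 - 2 * d 2 / d 0 = (7 - 2 * \<nu>) / (45 * (2 * \<nu> + 3) ^ 2 * (2 * \<nu> + 5))"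
    using pos unfolding d by (simp_all add: divide_simps) (simp_all add: eval_nat_numeral algebra_simps)?
  have e': "d' 1 / d' 0 = (\<nu> + 3) / (3 * (\<nu> + 1) * (2 * \<nu> + 3))"
      "(d' 1 / d' 0)\<^sup>2 - 2 * d' 2 / d' 0 = (- 2 * \<nu> ^ 3 - 5 * \<nu> ^ 2 + 72 * \<nu> + 135) /
         (45 * (\<nu> + 1) ^ 2 * (2 * \<nu> + 3) ^ 2 * (2 * \<nu> + 5))"
    using pos unfolding d' d by (simp_all add: divide_simps) (simp_all add: eval_nat_numeral algebra_simps)?
  show ?thesis
  proof (intro conjI impI)
    show "(\<lambda>n. 1 / pos_zero (struve_H (of_real \<nu>)) n ^ 2) sums (1 / (3 * (2 * \<nu> + 3)))"
         "(\<lambda>n. 1 / pos_zero (struve_H (of_real \<nu>)) n ^ 4) sums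
            ((7 - 2 * \<nu>) / (45 * (2 * \<nu> + 3) ^ 2 * (2 * \<nu> + 5)))"
      using D.pos_zero_sums[OF H] unfolding e(2) unfolding e(1) .
    have "K / 2 \<noteq> 0" using H(1) by simp
    from D'.pos_zero_sums[OF this H']
    show "(\<lambda>n. 1 / pos_zero (deriv (struve_H (of_real \<nu>))) n ^ 2) sums
           ((\<nu> + 3) / (3 * (\<nu> + 1) * (2 * \<nu> + 3)))"
         "(\<lambda>n. 1 / pos_zero (deriv (struve_H (of_real \<nu>))) n ^ 4) sums
           ((- 2 * \<nu> ^ 3 - 5 * \<nu> ^ 2 + 72 * \<nu> + 135) /
            (45 * (\<nu> + 1) ^ 2 * (2 * \<nu> + 3) ^ 2 * (2 * \<nu> + 5)))"
      unfolding e'(2) unfolding e'(1) by blast+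
  next
    assume "0 < \<nu>"
    \<comment> \<open>The second Euler operator has \<open>s = \<nu>\<close>, so
      \<open>0 < \<nu>\<close> is what makes \<open>d'' 0 = \<nu> * (\<nu> + 1)\<close> positive and
      keeps the roots positive.\<close>
    interpret D'': pos_root_series d'' "1 * (2 + (\<nu> + 1)) * (2 + \<nu>)" "2 * (2 * 1)"
      unfolding d''_def using \<open>0 < \<nu>\<close> by (rule D'.euler_operator_pos_root_series)
    have e'': "d'' 1 / d'' 0 = (\<nu> + 2) * (\<nu> + 3) / (3 * \<nu> * (\<nu> + 1) * (2 * \<nu> + 3))"
        "(d'' 1 / d'' 0)\<^sup>2 - 2 * d'' 2 / d'' 0 =
          (- 2 * \<nu> ^ 5 - 13 * \<nu> ^ 4 + 92 * \<nu> ^ 3 + 763 * \<nu> ^ 2 + 1500 * \<nu> + 900) /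
           (45 * \<nu> ^ 2 * (\<nu> + 1) ^ 2 * (2 * \<nu> + 3) ^ 2 * (2 * \<nu> + 5))"
      using pos \<open>0 < \<nu>\<close> unfolding d'' d by (simp_all add: divide_simps) (simp_all add: eval_nat_numeral algebra_simps)?
    have "K / 2 / 2 \<noteq> 0" using H(1) by simp
    from D''.pos_zero_sums[OF this H'']
    show "(\<lambda>n. 1 / pos_zero (deriv (deriv (struve_H (of_real \<nu>)))) n ^ 2) sums
            ((\<nu> + 2) * (\<nu> + 3) / (3 * \<nu> * (\<nu> + 1) * (2 * \<nu> + 3)))"
         "(\<lambda>n. 1 / pos_zero (deriv (deriv (struve_H (of_real \<nu>)))) n ^ 4) sums
            ((- 2 * \<nu> ^ 5 - 13 * \<nu> ^ 4 + 92 * \<nu> ^ 3 + 763 * \<nu> ^ 2 + 1500 * \<nu> + 900) /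
             (45 * \<nu> ^ 2 * (\<nu> + 1) ^ 2 * (2 * \<nu> + 3) ^ 2 * (2 * \<nu> + 5)))"
      unfolding e''(2) unfolding e''(1) by blast+
  qed
qed

end
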